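(* Let $\{C_i\}_{i\in\mathbb{N}}$ be a sequence of convex bodies in $\mathbb{R}^{n+1}$ that converges to a convex body $C\subset\mathbb{R}^{n+1}$ in Hausdorff distance. Then $J_{C_i}$ converges to $J_C$ pointwise in $[0,1]$. Consequently, also $y_{C_i}$ converges pointwise to $y_C$ in $[0,1]$.
   Context: Here $n\ge 1$. A convex body in $\mathbb{R}^{n+1}$ is a compact convex set with non-empty interior. The Hausdorff distance is $\delta(C,C')=\inf\{r>0: C\subset (C')_r,\ C'\subset C_r\}$, where $C_r$ is the set of points at Euclidean distance at most $r$ from $C$. $|E|$ denotes $(n+1)$-dimensional Lebesgue measure. For measurable $E\subset C$, the relative perimeter is $P_C(E)=\sup\{\int_E \mathrm{div}\,\xi : \xi \text{ smooth vector field with compact support in } \mathrm{int}(C),\ |\xi|\le 1\}$. The isoperimetric profile is $I_C(v)=\inf\{P_C(E): E\subset C,\ |E|=v\}$ for $0\le v\le |C|$. The normalized profiles are $J_C:[0,1]\to[0,\infty)$, $J_C(\lambda)=I_C(\lambda |C|)$, and $y_C=J_C^{(n+1)/n}$. *)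

theory Defs
  imports "HOL-Analysis.Analysis"
begin

definition convex_body :: "'a::euclidean_space set \<Rightarrow> bool" where
  "convex_body C \<longleftrightarrow> compact C \<and> convex C \<and> interior C \<noteq> {}"

definition closed_nbhd :: "'a::metric_space set \<Rightarrow> real \<Rightarrow> 'a set" where
  "closed_nbhd C r = {x. infdist x C \<le> r}"

definition hausdorff_distance :: "'a::metric_space set \<Rightarrow> 'a set \<Rightarrow> real" where
  "hausdorff_distance C D = Inf {r. r > 0 \<and> C \<subseteq> closed_nbhd D r \<and> D \<subseteq> closed_nbhd C r}"

(* C^k on the whole space: all iterated directional derivatives up to order k exist as Frechet
   derivatives and are continuous (continuity at the orders below k follows from
   differentiability). *)
primrec Ck :: "nat \<Rightarrow> ('a::euclidean_space \<Rightarrow> 'b::real_normed_vector) \<Rightarrow> bool" where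
  "Ck 0 f \<longleftrightarrow> continuous_on UNIV f"
| "Ck (Suc k) f \<longleftrightarrow>
     (\<forall>x. f differentiable (at x)) \<and> (\<forall>v. Ck k (\<lambda>x. frechet_derivative f (at x) v))"

definition smooth :: "('a::euclidean_space \<Rightarrow> 'b::real_normed_vector) \<Rightarrow> bool" where
  "smooth f \<longleftrightarrow> (\<forall>k. Ck k f)"

definition div_field :: "('a::euclidean_space \<Rightarrow> 'a) \<Rightarrow> 'a \<Rightarrow> real" where
  "div_field \<xi> x = (\<Sum>b\<in>Basis. frechet_derivative \<xi> (at x) b \<bullet> b)"

(* Fields with compact support in the interior of C are represented by their extension by zero
   to the whole space. *)
definition test_fields :: "'a::euclidean_space set \<Rightarrow> ('a \<Rightarrow> 'a) set" where
  "test_fields C = {\<xi>. smooth \<xi> \<and> compact (closure {x. \<xi> x \<noteq> 0})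
     \<and> closure {x. \<xi> x \<noteq> 0} \<subseteq> interior C \<and> (\<forall>x. norm (\<xi> x) \<le> 1)}"

(* Extended-real valued, since a measurable set may have infinite perimeter. *)
definition rel_perimeter :: "'a::euclidean_space set \<Rightarrow> 'a set \<Rightarrow> ereal" where
  "rel_perimeter C E = (SUP \<xi>\<in>test_fields C. ereal (LINT x:E|lebesgue. div_field \<xi> x))"

definition iso_profile :: "'a::euclidean_space set \<Rightarrow> real \<Rightarrow> ereal" where
  "iso_profile C v =
     (INF E\<in>{E. E \<subseteq> C \<and> E \<in> sets lebesgue \<and> measure lebesgue E = v}. rel_perimeter C E)"

(* For a convex body C and 0 <= s <= 1 the profile is finite: half-space sections of C attain
   every volume and have finite relative perimeter. So the coercion below loses nothing there;
   outside [0,1] the value is irrelevant. *)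
definition norm_profile :: "'a::euclidean_space set \<Rightarrow> real \<Rightarrow> real" where
  "norm_profile C s = real_of_ereal (iso_profile C (s * measure lebesgue C))"

(* To be used with n + 1 the dimension of the space. *)
definition norm_profile_pow :: "nat \<Rightarrow> 'a::euclidean_space set \<Rightarrow> real \<Rightarrow> real" where
  "norm_profile_pow n C s = norm_profile C s powr (real (n + 1) / real n)"

end

theory Submission
  imports Defs
begin

text \<open>
  Write \<open>d\<close> for the dimension, \<open>I(D)\<close> for the profile of \<open>D\<close> at the volume \<open>s |D|\<close>, and let \<open>c\<close> be an
  interior point of \<open>C\<close>. The proof compares the profiles of nearby bodies directly, without
  minimizers, and rests on four observations.
  
  \<^enum> A convex body that is Hausdorff close to \<open>C\<close> lies between the copies of \<open>C\<close> scaled about \<open>c\<close>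
    by \<open>1 - \<eta>\<close> and \<open>1 + \<eta>\<close> (\<open>convex_body_sandwich\<close>).
  
  \<^enum> Scaling by \<open>t\<close> multiplies volume by \<open>t ^ d\<close> and relative perimeter by \<open>t ^ (d - 1)\<close>, so the
    profiles of the two scaled copies are close to that of \<open>C\<close> (\<open>iso_profile_homothety_le\<close>).
  
  \<^enum> Restricting a set \<open>E \<subseteq> C\<close> to a smaller domain \<open>D\<close> does not increase its relative perimeter, as
    there are fewer test fields; it only disturbs the volume, by at most \<open>|C| - |D|\<close>.
  
  \<^enum> A small error of volume can be repaired at a small cost of perimeter (\<open>volume_fixing\<close>). To
    lose volume, cut out of \<open>E\<close> a ball of radius at most \<open>h\<close>, which costs at most a constant times
    \<open>h ^ (d - 1)\<close>. This tends to \<open>0\<close> with \<open>h\<close> because \<open>d \<ge> 2\<close>. Some ball of radius \<open>h\<close> contains enough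
    of \<open>E\<close>, since a bounded region is covered by finitely many of them. To gain volume, do the
    same to the complement of \<open>E\<close> in \<open>C\<close>, which has no more relative perimeter than \<open>E\<close> by the
    divergence theorem.
  
  The last two points give \<open>I(D) \<le> I(C) + \<epsilon>\<close> whenever \<open>D \<subseteq> C\<close> has almost the volume of \<open>C\<close>
  (\<open>iso_profile_subdomain\<close>). Applied to both inclusions of the sandwich this bounds the profile of
  \<open>C\<^sub>i\<close> by that of \<open>C\<close> and conversely, up to errors that vanish with \<open>\<eta>\<close>. At \<open>s = 0\<close> and \<open>s = 1\<close> the
  argument has no room to adjust volumes, but there all profiles vanish.
  
  The cost of cutting out a ball is estimated with smooth cutoffs \<open>\<phi>\<close>: if \<open>\<xi>\<close> is a test field then so is
  \<open>\<phi> \<xi>\<close>, and the divergence of \<open>\<phi> \<xi>\<close> differs from \<open>\<phi>\<close> times that of \<open>\<xi>\<close> by at most the size of the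
  gradient of \<open>\<phi>\<close>, which lives on a thin spherical shell.
\<close>

section \<open>Smooth functions\<close>

lemma Ck_SucI:
  assumes "\<And>x. (f has_derivative f' x) (at x)" and "\<And>v. Ck k (\<lambda>x. f' x v)"
  shows "Ck (Suc k) f"
proof -
  have "frechet_derivative f (at x) = f' x" for x
    using frechet_derivative_at[OF assms(1)] by simp
  then show ?thesis
    using assms by (auto simp: differentiable_def)
qed

lemma Ck_Suc_D:
  assumes "Ck (Suc k) f"
  shows "(f has_derivative frechet_derivative f (at x)) (at x)"
    and "Ck k (\<lambda>x. frechet_derivative f (at x) v)"
  using assms frechet_derivative_works by auto

lemma Ck_imp_continuous: "Ck k f \<Longrightarrow> continuous_on UNIV f"
  by (cases k) (auto intro!: continuous_at_imp_continuous_on differentiable_imp_continuous_within)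

lemma Ck_Suc_imp_Ck: "Ck (Suc k) f \<Longrightarrow> Ck k f"
proof (induction k arbitrary: f)
  case 0
  then show ?case using Ck_imp_continuous by (simp only: Ck.simps(1)) blast
next
  case (Suc k)
  then show ?case by (metis Ck.simps(2))
qed

lemma Ck_const: "Ck k (\<lambda>x. c)"
  by (induction k arbitrary: c) (auto intro!: Ck_SucI derivative_eq_intros)

lemma Ck_bounded_linear: "bounded_linear f \<Longrightarrow> Ck k f"
  by (cases k) (auto intro!: Ck_SucI bounded_linear_imp_has_derivative Ck_const
      linear_continuous_on simp del: Ck.simps(2))

lemma Ck_add: "Ck k f \<Longrightarrow> Ck k g \<Longrightarrow> Ck k (\<lambda>x. f x + g x)"
proof (induction k arbitrary: f g)
  case (Suc k)
  show ?case
    by (rule Ck_SucI[OF has_derivative_add[OF Ck_Suc_D(1)[OF Suc.prems(1)] Ck_Suc_D(1)[OF Suc.prems(2)]]])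
       (intro Suc.IH Ck_Suc_D(2) Suc.prems)
qed (auto intro: continuous_intros)

lemma Ck_scaleR:
  fixes \<phi> :: "'a::euclidean_space \<Rightarrow> real"
  shows "Ck k \<phi> \<Longrightarrow> Ck k f \<Longrightarrow> Ck k (\<lambda>x. \<phi> x *\<^sub>R f x)"
proof (induction k arbitrary: \<phi> f)
  case (Suc k)
  show ?case
    by (rule Ck_SucI[OF has_derivative_scaleR[OF Ck_Suc_D(1)[OF Suc.prems(1)] Ck_Suc_D(1)[OF Suc.prems(2)]]])
       (intro Ck_add Suc.IH Ck_Suc_D(2) Suc.prems Ck_Suc_imp_Ck)
qed (auto intro: continuous_intros)

text \<open>
  By the chain rule the derivative of \<open>G \<circ> q\<close> in direction \<open>v\<close> is the product of the derivative of \<open>q\<close>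
  and of \<open>G' \<circ> q\<close>, to which the induction hypothesis and the product rule apply.
\<close>

lemma Ck_compose_real:
  fixes q :: "'a::euclidean_space \<Rightarrow> real"
  shows "Ck k G \<Longrightarrow> Ck k q \<Longrightarrow> Ck k (\<lambda>x. G (q x))"
proof (induction k arbitrary: G q)
  case 0
  then show ?case
    using continuous_on_compose2[of UNIV G UNIV q] by auto
next
  case (Suc k)
  have eq: "frechet_derivative G (at (q x)) (frechet_derivative q (at x) v)
      = frechet_derivative q (at x) v *\<^sub>R frechet_derivative G (at (q x)) 1" for x v
    using linear_scale[OF has_derivative_linear[OF Ck_Suc_D(1)[OF Suc.prems(1)]],
        of "q x" "frechet_derivative q (at x) v" 1] by simp
  have "Ck k (\<lambda>x. frechet_derivative G (at (q x)) (frechet_derivative q (at x) v))" for v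
    unfolding eq
    by (intro Ck_scaleR Ck_Suc_D(2) Suc.prems Suc.IH[OF Ck_Suc_D(2)] Ck_Suc_imp_Ck)
  then show ?case
    by (rule Ck_SucI[OF has_derivative_compose[OF Ck_Suc_D(1)[OF Suc.prems(2)] Ck_Suc_D(1)[OF Suc.prems(1)]]])
qed

lemma Ck_homothety: "Ck k f \<Longrightarrow> Ck k (\<lambda>x. f (t *\<^sub>R x + a))"
proof (induction k arbitrary: f)
  case 0
  then show ?case
    by (auto intro!: continuous_on_compose2[of UNIV f UNIV] continuous_intros)
next
  case (Suc k)
  have "((\<lambda>x. f (t *\<^sub>R x + a)) has_derivative
      (\<lambda>v. frechet_derivative f (at (t *\<^sub>R x + a)) (t *\<^sub>R v))) (at x)" for x
    by (rule has_derivative_compose[OF _ Ck_Suc_D(1)[OF Suc.prems]]) (auto intro!: derivative_eq_intros)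
  then show ?case
    by (rule Ck_SucI) (rule Suc.IH[OF Ck_Suc_D(2)[OF Suc.prems]])
qed

lemma smooth_has_derivative: "smooth f \<Longrightarrow> (f has_derivative frechet_derivative f (at x)) (at x)"
  using Ck_Suc_D(1) unfolding smooth_def by blast

lemma smooth_frechet_derivative: "smooth f \<Longrightarrow> smooth (\<lambda>x. frechet_derivative f (at x) v)"
  using Ck_Suc_D(2) unfolding smooth_def by blast

lemma smooth_imp_continuous: "smooth f \<Longrightarrow> continuous_on UNIV f"
  using Ck_imp_continuous unfolding smooth_def by blast

lemma smooth_const: "smooth (\<lambda>x. c)"
  by (simp add: smooth_def Ck_const)

lemma smooth_scaleR:
  fixes \<phi> :: "'a::euclidean_space \<Rightarrow> real"
  shows "smooth \<phi> \<Longrightarrow> smooth f \<Longrightarrow> smooth (\<lambda>x. \<phi> x *\<^sub>R f x)"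
  by (simp add: smooth_def Ck_scaleR)

text \<open>
  Multiples of \<open>exp (- 1 / t)\<close> by powers of \<open>1 / t\<close>, extended by \<open>0\<close> to \<open>t \<le> 0\<close>. The span of this family is
  closed under differentiation, so every member is smooth. The factor \<open>exp 1\<close> makes \<open>flat 0 1 = 1\<close>.
\<close>

definition flat :: "nat \<Rightarrow> real \<Rightarrow> real" where
  "flat k t = (if t > 0 then (1 / t) ^ k * exp (1 - 1 / t) else 0)"

lemma flat_tendsto_0_right: "(flat k \<longlongrightarrow> 0) (at_right 0)"
proof -
  have "filterlim (\<lambda>t::real. 1 / t) at_top (at_right 0)"
    using filterlim_inverse_at_top_right by (simp add: inverse_eq_divide)
  from filterlim_compose[OF tendsto_power_div_exp_0 this]
  have "((\<lambda>t::real. exp 1 * ((1 / t) ^ k / exp (1 / t))) \<longlongrightarrow> exp 1 * 0) (at_right 0)"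
    by (intro tendsto_mult tendsto_const)
  moreover have "\<forall>\<^sub>F t in at_right 0. exp 1 * ((1 / t) ^ k / exp (1 / t)) = flat k t"
    by (intro eventually_at_rightI[of 0 1]) (auto simp: flat_def exp_diff)
  ultimately show ?thesis
    by (simp add: filterlim_cong)
qed

lemma flat_has_derivative:
  "(flat k has_real_derivative flat (k + 2) t - real k * flat (k + 1) t) (at t)"
proof -
  consider "t < 0" | "t = 0" | "t > 0" by linarith
  then show ?thesis
  proof cases
    case 1
    have "((\<lambda>t. 0) has_real_derivative 0) (at t)" by simp
    then have "(flat k has_real_derivative 0) (at t)"
      by (rule has_field_derivative_transform_within_open[where S="{..<0}"]) (use 1 in \<open>auto simp: flat_def\<close>)
    then show ?thesis using 1 by (simp add: flat_def)
  next
    case 2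
    have "((\<lambda>h. flat (k + 1) h) \<longlongrightarrow> 0) (at 0)"
    proof (rule filterlim_split_at)
      have "\<forall>\<^sub>F t in at_left 0. 0 = flat (k + 1) t"
        by (intro eventually_at_leftI[of "-1" 0]) (auto simp: flat_def)
      then show "(flat (k + 1) \<longlongrightarrow> 0) (at_left 0)"
        by (rule tendsto_eventually[OF eventually_mono]) auto
    qed (rule flat_tendsto_0_right)
    moreover have "flat (k + 1) h = (flat k (0 + h) - flat k 0) / h" for h
      by (auto simp: flat_def)
    ultimately show ?thesis using 2
      by (simp add: DERIV_def flat_def)
  next
    case 3
    define u where "u = 1 / t"
    have inv: "((\<lambda>t. 1 / t) has_real_derivative - (u * u)) (at t)"
      using 3 by (auto intro!: derivative_eq_intros simp: u_def)
    have "((\<lambda>t. (1 / t) ^ k) has_real_derivative real k * (- (u * u) * u ^ (k - Suc 0))) (at t)"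
      using DERIV_power[OF inv, of k] unfolding u_def .
    moreover have "((\<lambda>t. exp (1 - 1 / t)) has_real_derivative exp (1 - u) * (0 - (- (u * u)))) (at t)"
      using DERIV_fun_exp[OF DERIV_diff[OF DERIV_const[of 1] inv]] unfolding u_def .
    ultimately have "((\<lambda>t. (1 / t) ^ k * exp (1 - 1 / t)) has_real_derivative
        real k * (- (u * u) * u ^ (k - Suc 0)) * exp (1 - u)
        + exp (1 - u) * (0 - (- (u * u))) * u ^ k) (at t)"
      unfolding u_def by (rule DERIV_mult)
    also have "real k * (- (u * u) * u ^ (k - Suc 0)) * exp (1 - u)
        + exp (1 - u) * (0 - (- (u * u))) * u ^ k
      = u ^ (k + 2) * exp (1 - u) - real k * (u ^ (k + 1) * exp (1 - u))"
      by (cases k) (simp_all add: algebra_simps)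
    finally have "((\<lambda>t. (1 / t) ^ k * exp (1 - 1 / t)) has_real_derivative
        (1 / t) ^ (k + 2) * exp (1 - 1 / t) - real k * ((1 / t) ^ (k + 1) * exp (1 - 1 / t))) (at t)"
      unfolding u_def .
    then have "(flat k has_real_derivative
        (1 / t) ^ (k + 2) * exp (1 - 1 / t) - real k * ((1 / t) ^ (k + 1) * exp (1 - 1 / t))) (at t)"
      by (rule has_field_derivative_transform_within_open[where S="{0<..}"]) (use 3 in \<open>auto simp: flat_def\<close>)
    then show ?thesis using 3 by (simp add: flat_def)
  qed
qed

lemma smooth_flat: "smooth (flat k)"
  unfolding smooth_def
proof
  fix j show "Ck j (flat k)"
  proof (induction j arbitrary: k)
    case 0
    show ?case
      by (auto intro!: continuous_at_imp_continuous_on DERIV_isCont[OF flat_has_derivative])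
  next
    case (Suc j)
    have "Ck j (\<lambda>x. v *\<^sub>R (flat (k + 2) x + (- real k) *\<^sub>R flat (k + 1) x))" for v :: real
      by (intro Ck_scaleR Ck_add Ck_const Suc.IH)
    then have "Ck j (\<lambda>x. (flat (k + 2) x - real k * flat (k + 1) x) * v)" for v :: real
      by (simp add: mult.commute)
    then show ?case
      by (rule Ck_SucI[OF flat_has_derivative[unfolded has_field_derivative_def]])
  qed
qed

text \<open>
  A smooth transition from \<open>0\<close> on \<open>t \<le> 0\<close> to \<open>1\<close> on \<open>t \<ge> 1\<close>: for \<open>t \<ge> 1\<close> the inner \<open>flat 0 (1 - t)\<close> vanishes,
  and for \<open>t \<le> 0\<close> it is at least \<open>1\<close>, so that the outer argument is at most \<open>0\<close>.
\<close>

definition step :: "real \<Rightarrow> real" where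
  "step t = flat 0 (1 - flat 0 (1 - t))"

lemma smooth_step: "smooth step"
proof -
  have "Ck k (\<lambda>t. flat 0 ((-1) *\<^sub>R t + 1))" for k
    by (rule Ck_homothety) (use smooth_flat in \<open>simp add: smooth_def\<close>)
  then have "Ck k (\<lambda>t. 1 + (-1) *\<^sub>R flat 0 ((-1) *\<^sub>R t + 1))" for k
    by (intro Ck_add Ck_scaleR Ck_const)
  then have "Ck k (\<lambda>t. flat 0 (1 + (-1) *\<^sub>R flat 0 ((-1) *\<^sub>R t + 1)))" for k
    by (rule Ck_compose_real[of _ "flat 0", rotated]) (use smooth_flat in \<open>simp add: smooth_def\<close>)
  moreover have "step = (\<lambda>t. flat 0 (1 + (-1) *\<^sub>R flat 0 ((-1) *\<^sub>R t + 1)))"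
    by (auto simp: step_def fun_eq_iff)
  ultimately show ?thesis by (simp add: smooth_def)
qed

lemma step_bounds: "0 \<le> step t" "step t \<le> 1"
  by (auto simp: step_def flat_def divide_simps)

lemma step_eq_0: "t \<le> 0 \<Longrightarrow> step t = 0"
  by (auto simp: step_def flat_def divide_simps)

lemma step_eq_1: "1 \<le> t \<Longrightarrow> step t = 1"
  by (auto simp: step_def flat_def)

lemma step_derivative_bounded:
  obtains M where "M \<ge> 0" "\<And>t s. \<bar>frechet_derivative step (at t) s\<bar> \<le> M * \<bar>s\<bar> * indicator {0..1} t"
proof -
  let ?D = "\<lambda>t. frechet_derivative step (at t) 1"
  have "compact (?D ` {0..1})"
    using smooth_imp_continuous[OF smooth_frechet_derivative[OF smooth_step]]
    by (intro compact_continuous_image) (auto intro: continuous_on_subset)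
  from compact_imp_bounded[OF this] obtain M where M: "M > 0" "\<And>t. t \<in> {0..1} \<Longrightarrow> norm (?D t) \<le> M"
    unfolding bounded_pos by (meson imageI)
  have lin: "frechet_derivative step (at t) s = s * ?D t" for t s
    using linear_scale[OF has_derivative_linear[OF smooth_has_derivative[OF smooth_step]], of t s 1] by simp
  have zero: "?D t = 0" if "t \<notin> {0..1}" for t
  proof -
    consider "t < 0" | "t > 1" using \<open>t \<notin> {0..1}\<close> by force
    then have "(step has_derivative (\<lambda>x. 0)) (at t)"
    proof cases
      case 1
      show ?thesis
        by (rule has_derivative_transform_within_open[OF has_derivative_const[of 0] open_lessThan[of 0]])
           (use 1 step_eq_0 in auto)
    next
      case 2
      show ?thesis
        by (rule has_derivative_transform_within_open[OF has_derivative_const[of 1] open_greaterThan[of 1]])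
           (use 2 step_eq_1 in auto)
    qed
    from fun_cong[OF frechet_derivative_at[OF this], of 1] show ?thesis by simp
  qed
  show ?thesis
  proof (rule that[of M])
    fix t s
    show "\<bar>frechet_derivative step (at t) s\<bar> \<le> M * \<bar>s\<bar> * indicator {0..1} t"
    proof (cases "t \<in> {0..1}")
      case True
      then have "\<bar>s\<bar> * \<bar>?D t\<bar> \<le> \<bar>s\<bar> * M"
        using M(2)[of t] by (intro mult_left_mono) auto
      then show ?thesis using True by (subst lin) (simp add: abs_mult mult.commute)
    next
      case False
      then show ?thesis by (subst lin) (simp add: zero)
    qed
  qed (use M in auto)
qed

text \<open>
  The cutoff is the transition function applied to the quotient
  \<open>(|x - x0|\<^sup>2 - r\<^sup>2) / ((r + \<tau>)\<^sup>2 - r\<^sup>2)\<close>, which is a polynomial and hence smooth also at the centre. Its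
  gradient has norm at most \<open>2 (r + \<tau>) / (\<tau> (2 r + \<tau>)) \<le> 2 / \<tau>\<close> on the shell, whence a bound of the
  order of \<open>1 / \<tau>\<close> with a constant that depends neither on \<open>r\<close> nor on \<open>\<tau>\<close>.
\<close>

lemma ball_cutoff:
  obtains M where "M \<ge> 0"
    "\<And>(x0::'a::euclidean_space) r \<tau>. r \<ge> 0 \<Longrightarrow> \<tau> > 0 \<Longrightarrow> \<exists>\<phi>. smooth \<phi> \<and> (\<forall>x. 0 \<le> \<phi> x \<and> \<phi> x \<le> 1)
      \<and> (\<forall>x\<in>cball x0 r. \<phi> x = 0) \<and> (\<forall>x. x \<notin> ball x0 (r + \<tau>) \<longrightarrow> \<phi> x = 1)
      \<and> (\<forall>x v. \<bar>frechet_derivative \<phi> (at x) v\<bar>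
            \<le> M / \<tau> * norm v * indicator (cball x0 (r + \<tau>) - ball x0 r) x)"
proof -
  obtain M where M: "M \<ge> 0"
    "\<And>t s. \<bar>frechet_derivative step (at t) s\<bar> \<le> M * \<bar>s\<bar> * indicator {0..1} t"
    using step_derivative_bounded by blast
  show ?thesis
  proof (rule that[of "2 * M"])
    fix x0 :: 'a and r \<tau> :: real
    assume r: "r \<ge> 0" and \<tau>: "\<tau> > 0"
    define L where "L = (r + \<tau>)\<^sup>2 - r\<^sup>2"
    have L: "L = \<tau> * (2 * r + \<tau>)" "L > 0"
      using r \<tau> by (auto simp: L_def power2_eq_square algebra_simps intro!: add_pos_nonneg)
    define q where "q = (\<lambda>x. (1 / L) *\<^sub>R ((x - x0) \<bullet> (x - x0) - r\<^sup>2))"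
    define \<phi> where "\<phi> = (\<lambda>x. step (q x))"
    have q_deriv: "(q has_derivative (\<lambda>v. (2 / L) * ((x - x0) \<bullet> v))) (at x)" for x
      unfolding q_def using L(2) by (auto intro!: derivative_eq_intros simp: fun_eq_iff inner_commute)
    have "Ck k (\<lambda>x. (2 / L) *\<^sub>R (x \<bullet> v + - (x0 \<bullet> v)))" for k v
      by (rule Ck_scaleR[OF Ck_const Ck_add[OF Ck_bounded_linear[OF bounded_linear_inner_left] Ck_const]])
    then have "Ck k (\<lambda>x. (2 / L) * ((x - x0) \<bullet> v))" for k v
      by (simp add: inner_diff_left)
    then have "Ck (Suc k) q" for k
      by (rule Ck_SucI[OF q_deriv])
    then have "smooth q"
      unfolding smooth_def using Ck_Suc_imp_Ck[of _ q] by iprover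
    then have "smooth \<phi>"
      using smooth_step Ck_compose_real[of _ step q] by (simp add: smooth_def \<phi>_def)
    moreover have "\<forall>x. 0 \<le> \<phi> x \<and> \<phi> x \<le> 1"
      by (simp add: \<phi>_def step_bounds)
    moreover have q_le_0: "q x \<le> 0 \<longleftrightarrow> norm (x - x0) \<le> r" for x
      using L(2) r by (simp add: q_def power2_norm_eq_inner[symmetric] divide_le_0_iff power_mono_iff)
    moreover have q_ge_1: "1 \<le> q x \<longleftrightarrow> r + \<tau> \<le> norm (x - x0)" for x
    proof -
      have "1 \<le> q x \<longleftrightarrow> (r + \<tau>)\<^sup>2 \<le> (norm (x - x0))\<^sup>2"
      proof -
        have "1 \<le> q x \<longleftrightarrow> L \<le> (norm (x - x0))\<^sup>2 - r\<^sup>2"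
          using L(2) by (simp add: q_def power2_norm_eq_inner[symmetric] pos_le_divide_eq)
        then show ?thesis by (auto simp: L_def)
      qed
      then show ?thesis using r \<tau> by (simp add: power_mono_iff)
    qed
    moreover have "\<bar>frechet_derivative \<phi> (at x) v\<bar>
            \<le> 2 * M / \<tau> * norm v * indicator (cball x0 (r + \<tau>) - ball x0 r) x" for x v
    proof -
      have "(\<phi> has_derivative (\<lambda>v. frechet_derivative step (at (q x)) ((2 / L) * ((x - x0) \<bullet> v)))) (at x)"
        unfolding \<phi>_def
        by (rule has_derivative_compose[OF q_deriv smooth_has_derivative[OF smooth_step]])
      from fun_cong[OF frechet_derivative_at[OF this], of v]
      have "frechet_derivative \<phi> (at x) v = frechet_derivative step (at (q x)) ((2 / L) * ((x - x0) \<bullet> v))"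
        by simp
      then have le: "\<bar>frechet_derivative \<phi> (at x) v\<bar> \<le> M * \<bar>(2 / L) * ((x - x0) \<bullet> v)\<bar> * indicator {0..1} (q x)"
        using M(2) by (simp only:)
      show ?thesis
      proof (cases "q x \<in> {0..1}")
        case False
        then have "\<bar>frechet_derivative \<phi> (at x) v\<bar> = 0"
          using le by simp
        then show ?thesis using M(1) \<tau> by (auto simp: indicator_def)
      next
        case True
        have n: "norm (x - x0) \<le> r + \<tau>"
        proof (rule ccontr)
          assume n: "\<not> norm (x - x0) \<le> r + \<tau>"
          then have "(r + \<tau>)\<^sup>2 < (norm (x - x0))\<^sup>2" using r \<tau> by (intro power_strict_mono) auto
          then have "q x > 1"
            using L(2) unfolding q_def power2_norm_eq_inner[symmetric] by (simp add: pos_less_divide_eq L_def)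
          then show False using True by simp
        qed
        moreover have "r \<le> norm (x - x0)"
        proof (rule ccontr)
          assume n: "\<not> r \<le> norm (x - x0)"
          then have "(norm (x - x0))\<^sup>2 < r\<^sup>2" using r \<tau> by (intro power_strict_mono) auto
          then have "q x < 0"
            using L(2) by (simp add: q_def power2_norm_eq_inner[symmetric] divide_less_0_iff)
          then show False using True by simp
        qed
        ultimately have "x \<in> cball x0 (r + \<tau>) - ball x0 r"
          by (auto simp: dist_norm norm_minus_commute)
        moreover have "\<bar>(2 / L) * ((x - x0) \<bullet> v)\<bar> \<le> 2 / \<tau> * norm v"
        proof -
          have "\<bar>(2 / L) * ((x - x0) \<bullet> v)\<bar> \<le> 2 / L * (norm (x - x0) * norm v)"
            using L(2) Cauchy_Schwarz_ineq2[of "x - x0" v] by (simp add: abs_mult divide_right_mono)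
          also have "\<dots> \<le> 2 / L * ((2 * r + \<tau>) * norm v)"
            using n L(2) r by (intro mult_left_mono mult_right_mono) auto
          also have "\<dots> = 2 / \<tau> * norm v"
            using L r \<tau> by (simp add: field_simps)
          finally show ?thesis .
        qed
        then have "M * \<bar>(2 / L) * ((x - x0) \<bullet> v)\<bar> \<le> M * (2 / \<tau> * norm v)"
          using M(1) by (rule mult_left_mono)
        ultimately show ?thesis using le True by (simp add: algebra_simps)
      qed
    qed
    ultimately show "\<exists>\<phi>. smooth \<phi> \<and> (\<forall>x. 0 \<le> \<phi> x \<and> \<phi> x \<le> 1)
      \<and> (\<forall>x\<in>cball x0 r. \<phi> x = 0) \<and> (\<forall>x. x \<notin> ball x0 (r + \<tau>) \<longrightarrow> \<phi> x = 1)
      \<and> (\<forall>x v. \<bar>frechet_derivative \<phi> (at x) v\<bar>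
            \<le> 2 * M / \<tau> * norm v * indicator (cball x0 (r + \<tau>) - ball x0 r) x)"
      by (intro exI[of _ \<phi>]) (auto simp: \<phi>_def dist_norm norm_minus_commute intro!: step_eq_0 step_eq_1)
  qed (use M in auto)
qed

section \<open>Test fields and relative perimeter\<close>

lemma integrable_continuous_compact_support:
  fixes f :: "'a::euclidean_space \<Rightarrow> real"
  assumes "continuous_on UNIV f" "compact K" "\<And>x. x \<notin> K \<Longrightarrow> f x = 0"
  shows "integrable lborel f" "integrable lebesgue f"
proof -
  have "integrable lborel (\<lambda>x. indicator K x *\<^sub>R f x)"
    using assms by (intro borel_integrable_compact) (auto intro: continuous_on_subset)
  moreover have "(\<lambda>x. indicator K x *\<^sub>R f x) = f"
    using assms(3) by (auto simp: indicator_def fun_eq_iff)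
  ultimately show "integrable lborel f" by simp
  then show "integrable lebesgue f"
    by (subst integrable_completion) auto
qed

lemma continuous_imp_lebesgue_measurable:
  fixes f :: "'a::euclidean_space \<Rightarrow> real"
  shows "continuous_on UNIV f \<Longrightarrow> f \<in> borel_measurable lebesgue"
  by (rule measurable_completion) (simp add: borel_measurable_continuous_onI)

lemma frechet_derivative_eq_0_outside_support:
  assumes "x \<notin> closure {x. f x \<noteq> 0}"
  shows "frechet_derivative f (at x) v = 0"
proof -
  have "(f has_derivative (\<lambda>x. 0)) (at x)"
    by (rule has_derivative_transform_within_open[OF has_derivative_const[of 0], of "- closure {x. f x \<noteq> 0}"])
       (use assms closure_subset[of "{x. f x \<noteq> 0}"] in auto)
  from fun_cong[OF frechet_derivative_at[OF this], of v] show ?thesis by simp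
qed

lemma div_field_eq_0_outside_support:
  "x \<notin> closure {x. \<xi> x \<noteq> 0} \<Longrightarrow> div_field \<xi> x = 0"
  by (simp add: div_field_def frechet_derivative_eq_0_outside_support)

lemma continuous_div_field: "smooth \<xi> \<Longrightarrow> continuous_on UNIV (div_field \<xi>)"
  unfolding div_field_def
  by (intro continuous_intros smooth_imp_continuous[OF smooth_frechet_derivative])

lemma integrable_div_field:
  assumes "smooth \<xi>" "compact (closure {x. \<xi> x \<noteq> 0})"
  shows "integrable lebesgue (div_field \<xi>)"
  by (rule integrable_continuous_compact_support(2)[OF continuous_div_field assms(2)])
     (use assms div_field_eq_0_outside_support in auto)

lemma div_field_scaleR:
  assumes "smooth \<phi>" "smooth \<xi>"
  shows "div_field (\<lambda>x. \<phi> x *\<^sub>R \<xi> x) x = \<phi> x * div_field \<xi> x + frechet_derivative \<phi> (at x) (\<xi> x)"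
proof -
  let ?D = "frechet_derivative \<phi> (at x)"
  have lin: "linear ?D"
    using smooth_has_derivative[OF assms(1)] by (rule has_derivative_linear)
  have "((\<lambda>x. \<phi> x *\<^sub>R \<xi> x) has_derivative
      (\<lambda>h. \<phi> x *\<^sub>R frechet_derivative \<xi> (at x) h + ?D h *\<^sub>R \<xi> x)) (at x)"
    by (intro has_derivative_scaleR smooth_has_derivative assms)
  note D = frechet_derivative_at[OF this, symmetric]
  have "div_field (\<lambda>x. \<phi> x *\<^sub>R \<xi> x) x
      = (\<Sum>b\<in>Basis. \<phi> x * (frechet_derivative \<xi> (at x) b \<bullet> b) + ?D b * (\<xi> x \<bullet> b))"
    by (simp add: div_field_def D inner_add_left)
  also have "\<dots> = \<phi> x * div_field \<xi> x + (\<Sum>b\<in>Basis. ?D b * (\<xi> x \<bullet> b))"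
    by (simp add: div_field_def sum.distrib sum_distrib_left)
  also have "(\<Sum>b\<in>Basis. ?D b * (\<xi> x \<bullet> b)) = ?D (\<Sum>b\<in>Basis. (\<xi> x \<bullet> b) *\<^sub>R b)"
    by (simp add: linear_sum[OF lin] linear_scale[OF lin] mult.commute)
  finally show ?thesis by (simp add: euclidean_representation)
qed

lemma test_fieldsD:
  assumes "\<xi> \<in> test_fields C"
  shows "smooth \<xi>" "compact (closure {x. \<xi> x \<noteq> 0})" "closure {x. \<xi> x \<noteq> 0} \<subseteq> interior C"
    "norm (\<xi> x) \<le> 1"
  using assms by (auto simp: test_fields_def)

lemma test_fields_scaleR:
  assumes "\<xi> \<in> test_fields C" "smooth \<phi>" "\<And>x. \<bar>\<phi> x\<bar> \<le> 1"
  shows "(\<lambda>x. \<phi> x *\<^sub>R \<xi> x) \<in> test_fields C"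
proof -
  have "closure {x. \<phi> x *\<^sub>R \<xi> x \<noteq> 0} \<subseteq> closure {x. \<xi> x \<noteq> 0}"
    by (intro closure_mono) auto
  moreover from this have "compact (closure {x. \<phi> x *\<^sub>R \<xi> x \<noteq> 0})"
    using compact_Int_closed[OF test_fieldsD(2)[OF assms(1)], of "closure {x. \<phi> x *\<^sub>R \<xi> x \<noteq> 0}"]
    by (simp only: inf.absorb2 closed_closure)
  moreover have "norm (\<phi> x *\<^sub>R \<xi> x) \<le> 1" for x
    using mult_mono[OF assms(3)[of x] test_fieldsD(4)[OF assms(1), of x]] by simp
  ultimately show ?thesis
    using assms(2) test_fieldsD[OF assms(1)] smooth_scaleR unfolding test_fields_def by blast
qed

lemma rel_perimeter_upper:
  "\<xi> \<in> test_fields C \<Longrightarrow> ereal (LINT x:E|lebesgue. div_field \<xi> x) \<le> rel_perimeter C E"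
  unfolding rel_perimeter_def by (rule SUP_upper)

lemma rel_perimeter_least:
  "(\<And>\<xi>. \<xi> \<in> test_fields C \<Longrightarrow> ereal (LINT x:E|lebesgue. div_field \<xi> x) \<le> p) \<Longrightarrow> rel_perimeter C E \<le> p"
  unfolding rel_perimeter_def by (rule SUP_least)

lemma rel_perimeter_nonneg: "0 \<le> rel_perimeter C E"
proof -
  have "(\<lambda>x. 0) \<in> test_fields C"
    by (simp add: test_fields_def smooth_const)
  from rel_perimeter_upper[OF this, of E] show ?thesis
    by (simp add: div_field_def zero_ereal_def)
qed

lemma rel_perimeter_empty: "rel_perimeter C {} = 0"
  by (intro antisym rel_perimeter_least rel_perimeter_nonneg) (simp add: set_lebesgue_integral_def)

lemma power_diff_le:
  fixes x y :: real
  assumes "0 \<le> y" "y \<le> x"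
  shows "x ^ n - y ^ n \<le> real n * (x - y) * x ^ (n - 1)"
proof -
  have "y ^ (n - Suc i) * x ^ i \<le> x ^ (n - 1)" if "i < n" for i
  proof -
    have "y ^ (n - Suc i) * x ^ i \<le> x ^ (n - Suc i) * x ^ i"
      using assms by (intro mult_right_mono power_mono) auto
    also have "\<dots> = x ^ (n - 1)" using that by (simp flip: power_add)
    finally show ?thesis .
  qed
  then have "(\<Sum>i<n. y ^ (n - Suc i) * x ^ i) \<le> real n * x ^ (n - 1)"
    using sum_bounded_above[of "{..<n}" "\<lambda>i. y ^ (n - Suc i) * x ^ i" "x ^ (n - 1)"] by simp
  from mult_left_mono[OF this, of "x - y"] show ?thesis
    using assms by (simp add: power_diff_sumr2 mult.commute mult.left_commute)
qed

text \<open>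
  The volume of a shell is of the order of its thickness times \<open>(r + \<tau>) ^ (d - 1)\<close>; the thickness cancels
  the factor \<open>1 / \<tau>\<close> in the gradient of the cutoff.
\<close>

lemma measure_shell_le:
  fixes x0 :: "'a::euclidean_space"
  assumes "0 \<le> r" "0 < \<tau>"
  shows "measure lebesgue (cball x0 (r + \<tau>) - ball x0 r)
    \<le> unit_ball_vol DIM('a) * (real DIM('a) * \<tau> * (r + \<tau>) ^ (DIM('a) - 1))"
proof -
  have "measure lebesgue (cball x0 (r + \<tau>) - ball x0 r)
      = measure lebesgue (cball x0 (r + \<tau>)) - measure lebesgue (ball x0 r)"
    using assms by (intro measurable_measure_Diff) auto
  also have "\<dots> = unit_ball_vol DIM('a) * ((r + \<tau>) ^ DIM('a) - r ^ DIM('a))"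
    using assms by (simp add: content_cball content_ball algebra_simps)
  also have "\<dots> \<le> unit_ball_vol DIM('a) * (real DIM('a) * \<tau> * (r + \<tau>) ^ (DIM('a) - 1))"
    using power_diff_le[of r "r + \<tau>" "DIM('a)"] assms by (intro mult_left_mono) auto
  finally show ?thesis .
qed

text \<open>
  The cost \<open>K h ^ (d - 1)\<close> is of the order of the area of a sphere of radius \<open>h\<close>. Let \<open>\<phi>\<close> be the cutoff that
  vanishes on the ball and is \<open>1\<close> outside the ball with radius enlarged by \<open>\<tau>\<close>. As \<open>\<phi> \<xi>\<close> is again a test
  field, the integral over \<open>E\<close> of \<open>\<phi>\<close> times the divergence of \<open>\<xi>\<close> is at most the perimeter of \<open>E\<close> plus the
  integral of \<open>M / \<tau>\<close> over the shell, and the latter stays bounded. Then \<open>\<tau>\<close> tends to \<open>0\<close>.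
\<close>

lemma rel_perimeter_Diff_cball:
  obtains K where "K \<ge> 0"
    "\<And>C E (x0::'a::euclidean_space) r h. (E::'a set) \<in> sets lebesgue \<Longrightarrow> 0 \<le> r \<Longrightarrow> r \<le> h \<Longrightarrow> 0 < h \<Longrightarrow>
      rel_perimeter C (E - cball x0 r) \<le> rel_perimeter C E + ereal (K * h ^ (DIM('a) - 1))"
proof -
  let ?d = "DIM('a)"
  obtain M where M: "M \<ge> 0"
    "\<And>(x0::'a) r \<tau>. r \<ge> 0 \<Longrightarrow> \<tau> > 0 \<Longrightarrow> \<exists>\<phi>. smooth \<phi> \<and> (\<forall>x. 0 \<le> \<phi> x \<and> \<phi> x \<le> 1)
      \<and> (\<forall>x\<in>cball x0 r. \<phi> x = 0) \<and> (\<forall>x. x \<notin> ball x0 (r + \<tau>) \<longrightarrow> \<phi> x = 1)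
      \<and> (\<forall>x v. \<bar>frechet_derivative \<phi> (at x) v\<bar>
            \<le> M / \<tau> * norm v * indicator (cball x0 (r + \<tau>) - ball x0 r) x)"
    by (rule ball_cutoff) blast
  define K where "K = M * unit_ball_vol ?d * ?d * 2 ^ (?d - 1)"
  show ?thesis
  proof (rule that[of K])
    show "K \<ge> 0" using M(1) by (simp add: K_def)
    fix C E :: "'a set" and x0 :: 'a and r h :: real
    assume E: "E \<in> sets lebesgue" and r: "0 \<le> r" "r \<le> h" and h: "0 < h"
    show "rel_perimeter C (E - cball x0 r) \<le> rel_perimeter C E + ereal (K * h ^ (?d - 1))"
    proof (cases "rel_perimeter C E")
      case PInf
      then show ?thesis by simp
    next
      case MInf
      then show ?thesis using rel_perimeter_nonneg[of C E] by simp
    next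
      case (real p)
      show ?thesis
      proof (rule rel_perimeter_least)
        fix \<xi> assume \<xi>: "\<xi> \<in> test_fields C"
        note \<xi>D = test_fieldsD[OF \<xi>]
        \<comment> \<open>The thickness never exceeds \<open>h\<close>, so all shells lie in a ball of radius \<open>2 h\<close>,
            which is the source of the factor \<open>2 ^ (d - 1)\<close> in \<open>K\<close>.\<close>
        define \<tau> where "\<tau> k = h / real (Suc k)" for k
        have \<tau>: "\<tau> k > 0" "\<tau> k \<le> h" for k
          using h by (auto simp: \<tau>_def divide_simps mult_left_mono)
        have "\<forall>k. \<exists>\<phi>. smooth \<phi> \<and> (\<forall>x. 0 \<le> \<phi> x \<and> \<phi> x \<le> 1)
          \<and> (\<forall>x\<in>cball x0 r. \<phi> x = 0) \<and> (\<forall>x. x \<notin> ball x0 (r + \<tau> k) \<longrightarrow> \<phi> x = 1)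
          \<and> (\<forall>x v. \<bar>frechet_derivative \<phi> (at x) v\<bar>
            \<le> M / \<tau> k * norm v * indicator (cball x0 (r + \<tau> k) - ball x0 r) x)"
          using M(2)[OF r(1) \<tau>(1)] by blast
        from choice[OF this] obtain \<phi> where \<phi>: "\<And>k. smooth (\<phi> k)" "\<And>k x. 0 \<le> \<phi> k x" "\<And>k x. \<phi> k x \<le> 1"
          "\<And>k x. x \<in> cball x0 r \<Longrightarrow> \<phi> k x = 0" "\<And>k x. x \<notin> ball x0 (r + \<tau> k) \<Longrightarrow> \<phi> k x = 1"
          "\<And>k x v. \<bar>frechet_derivative (\<phi> k) (at x) v\<bar>
            \<le> M / \<tau> k * norm v * indicator (cball x0 (r + \<tau> k) - ball x0 r) x"
          by blast
        have int_div: "integrable lebesgue (div_field \<xi>)"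
          by (rule integrable_div_field[OF \<xi>D(1,2)])
        have [measurable]: "div_field \<xi> \<in> borel_measurable lebesgue" "\<phi> k \<in> borel_measurable lebesgue" for k
          using continuous_div_field[OF \<xi>D(1)] smooth_imp_continuous[OF \<phi>(1)]
          by (auto intro: continuous_imp_lebesgue_measurable)
        have lim: "(\<lambda>k. LINT x|lebesgue. indicator E x * (\<phi> k x * div_field \<xi> x))
            \<longlonglongrightarrow> (LINT x|lebesgue. indicator (E - cball x0 r) x * div_field \<xi> x)"
        proof (rule integral_dominated_convergence[where w="\<lambda>x. \<bar>div_field \<xi> x\<bar>"])
          show "AE x in lebesgue. (\<lambda>k. indicator E x * (\<phi> k x * div_field \<xi> x))
              \<longlonglongrightarrow> indicator (E - cball x0 r) x * div_field \<xi> x"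
          proof (rule AE_I2)
            fix x
            show "(\<lambda>k. indicator E x * (\<phi> k x * div_field \<xi> x))
              \<longlonglongrightarrow> indicator (E - cball x0 r) x * div_field \<xi> x"
            proof (cases "x \<in> cball x0 r")
              case True
              then show ?thesis using \<phi>(4) by simp
            next
              case False
              have "\<tau> \<longlonglongrightarrow> 0"
                unfolding \<tau>_def using LIMSEQ_Suc[OF lim_const_over_n[of h]] by simp
              then have "\<forall>\<^sub>F k in sequentially. \<tau> k < dist x0 x - r"
                using False by (intro order_tendstoD) auto
              then have "\<forall>\<^sub>F k in sequentially.
                  indicator E x * (\<phi> k x * div_field \<xi> x) = indicator (E - cball x0 r) x * div_field \<xi> x"
                by eventually_elim (use False \<phi>(5)[of x] in \<open>auto simp: indicator_def\<close>)
              then show ?thesis by (rule tendsto_eventually)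
            qed
          qed
          show "AE x in lebesgue. norm (indicator E x * (\<phi> k x * div_field \<xi> x)) \<le> \<bar>div_field \<xi> x\<bar>" for k
            using \<phi>(2,3)[of k] by (intro AE_I2) (auto simp: abs_mult indicator_def mult_left_le_one_le)
        qed (use int_div E in \<open>auto intro!: borel_measurable_times borel_measurable_indicator sets.Diff\<close>)
        have "(LINT x|lebesgue. indicator E x * (\<phi> k x * div_field \<xi> x)) \<le> p + K * h ^ (?d - 1)" for k
        proof -
          let ?\<psi> = "\<lambda>x. \<phi> k x *\<^sub>R \<xi> x"
          let ?S = "cball x0 (r + \<tau> k) - ball x0 r"
          have \<psi>: "?\<psi> \<in> test_fields C"
            by (rule test_fields_scaleR[OF \<xi> \<phi>(1)]) (use \<phi>(2,3)[of k] in auto)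
          have int_\<psi>: "integrable lebesgue (\<lambda>x. indicator E x * div_field ?\<psi> x)"
            using integrable_mult_indicator[OF E integrable_div_field[OF test_fieldsD(1,2)[OF \<psi>]]] by simp
          have "?S \<in> lmeasurable"
            by (intro fmeasurable_Diff) auto
          then have int_S: "integrable lebesgue (\<lambda>x. M / \<tau> k * indicator ?S x)"
            by (intro integrable_mult_right integrable_real_indicator)
               (auto simp: fmeasurable_def)
          have "(LINT x|lebesgue. indicator E x * (\<phi> k x * div_field \<xi> x))
              \<le> (LINT x|lebesgue. indicator E x * div_field ?\<psi> x + M / \<tau> k * indicator ?S x)"
          proof (rule integral_mono)
            show "integrable lebesgue (\<lambda>x. indicator E x * (\<phi> k x * div_field \<xi> x))"
              by (rule Bochner_Integration.integrable_bound[OF int_div])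
                 (use E \<phi>(2,3)[of k] in \<open>auto simp: abs_mult indicator_def mult_left_le_one_le
                    intro!: borel_measurable_times borel_measurable_indicator\<close>)
            show "integrable lebesgue (\<lambda>x. indicator E x * div_field ?\<psi> x + M / \<tau> k * indicator ?S x)"
              using int_\<psi> int_S by (rule Bochner_Integration.integrable_add)
            fix x
            have "\<bar>frechet_derivative (\<phi> k) (at x) (\<xi> x)\<bar> \<le> M / \<tau> k * norm (\<xi> x) * indicator ?S x"
              by (rule \<phi>(6))
            also have "\<dots> \<le> M / \<tau> k * 1 * indicator ?S x"
              using M(1) \<tau>(1)[of k] \<xi>D(4)[of x] by (intro mult_right_mono mult_left_mono) auto
            finally have "\<bar>frechet_derivative (\<phi> k) (at x) (\<xi> x)\<bar> \<le> M / \<tau> k * indicator ?S x" by simp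
            then show "indicator E x * (\<phi> k x * div_field \<xi> x)
                \<le> indicator E x * div_field ?\<psi> x + M / \<tau> k * indicator ?S x"
              unfolding div_field_scaleR[OF \<phi>(1) \<xi>D(1)]
              using M(1) \<tau>(1)[of k] by (auto simp: indicator_def)
          qed
          also have "\<dots> = (LINT x|lebesgue. indicator E x * div_field ?\<psi> x) + M / \<tau> k * measure lebesgue ?S"
            using int_\<psi> int_S by (subst Bochner_Integration.integral_add) auto
          also have "(LINT x|lebesgue. indicator E x * div_field ?\<psi> x) \<le> p"
            using rel_perimeter_upper[OF \<psi>, of E] real by (simp add: set_lebesgue_integral_def)
          also have "M / \<tau> k * measure lebesgue ?S \<le> K * h ^ (?d - 1)"
          proof -
            have "M / \<tau> k * measure lebesgue ?S
                \<le> M / \<tau> k * (unit_ball_vol ?d * (real ?d * \<tau> k * (r + \<tau> k) ^ (?d - 1)))"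
              using M(1) \<tau>(1)[of k] measure_shell_le[OF r(1) \<tau>(1)] by (intro mult_left_mono) auto
            also have "\<dots> = M * unit_ball_vol ?d * ?d * (r + \<tau> k) ^ (?d - 1)"
              using \<tau>(1)[of k] by simp
            also have "\<dots> \<le> M * unit_ball_vol ?d * ?d * (2 * h) ^ (?d - 1)"
              using M(1) r \<tau>[of k] by (intro mult_left_mono power_mono) auto
            finally show ?thesis by (simp add: K_def power_mult_distrib)
          qed
          finally show ?thesis by simp
        qed
        then have "(LINT x|lebesgue. indicator (E - cball x0 r) x * div_field \<xi> x) \<le> p + K * h ^ (?d - 1)"
          by (intro LIMSEQ_le_const2[OF lim]) auto
        then show "ereal (LINT x:E - cball x0 r|lebesgue. div_field \<xi> x) \<le> rel_perimeter C E + ereal (K * h ^ (?d - 1))"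
          by (simp add: real set_lebesgue_integral_def)
      qed
    qed
  qed
qed

section \<open>The divergence theorem and complements\<close>

text \<open>
  The difference quotients of \<open>f\<close> in direction \<open>v\<close> have integral \<open>0\<close> by translation invariance. The
  mean value theorem bounds them uniformly, and for step sizes up to \<open>1\<close> their supports stay in one
  ball, so dominated convergence passes to the derivative.
\<close>

lemma integral_directional_derivative_eq_0:
  fixes f :: "'a::euclidean_space \<Rightarrow> real"
  assumes deriv: "\<And>x. (f has_derivative D x) (at x)"
    and cont: "continuous_on UNIV (\<lambda>x. D x v)"
    and K: "compact K" "\<And>x. x \<notin> K \<Longrightarrow> f x = 0" "\<And>x. x \<notin> K \<Longrightarrow> D x v = 0"
  shows "(LINT x|lebesgue. D x v) = 0"
proof -
  have contf: "continuous_on UNIV f"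
    using deriv by (auto intro!: continuous_at_imp_continuous_on has_derivative_continuous)
  note int_f = integrable_continuous_compact_support(1)[OF contf K(1,2)]
  have "bounded ((\<lambda>x. D x v) ` K)"
    using cont K(1) by (intro compact_imp_bounded compact_continuous_image) (auto intro: continuous_on_subset)
  then obtain B where B: "B > 0" "\<And>x. x \<in> K \<Longrightarrow> \<bar>D x v\<bar> \<le> B"
    by (force simp: bounded_pos)
  then have B': "\<bar>D x v\<bar> \<le> B" for x
    using K(3)[of x] by (cases "x \<in> K") auto
  obtain R where R: "R > 0" "\<And>x. x \<in> K \<Longrightarrow> norm x \<le> R"
    using compact_imp_bounded[OF K(1)] by (auto simp: bounded_pos)
  define t where "t k = 1 / real (Suc k)" for k
  have t: "t k > 0" "t k \<le> 1" for k by (auto simp: t_def divide_simps)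
  have t_lim: "t \<longlonglongrightarrow> 0"
    unfolding t_def using LIMSEQ_Suc[OF lim_const_over_n[of 1]] by simp
  define q where "q k x = (f (t k *\<^sub>R v + x) - f x) / t k" for k x
  have line: "((\<lambda>u. f (x + u *\<^sub>R v)) has_real_derivative D (x + u *\<^sub>R v) v) (at u)" for x u
  proof -
    have "((\<lambda>u. f (x + u *\<^sub>R v)) has_derivative (\<lambda>s. D (x + u *\<^sub>R v) (s *\<^sub>R v))) (at u)"
      by (rule has_derivative_compose[OF _ deriv]) (auto intro!: derivative_eq_intros)
    moreover have "D (x + u *\<^sub>R v) (s *\<^sub>R v) = D (x + u *\<^sub>R v) v * s" for s
      using linear_scale[OF has_derivative_linear[OF deriv]] by simp
    ultimately show ?thesis by (simp add: has_field_derivative_def)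
  qed
  have q_bound: "\<bar>q k x\<bar> \<le> B" for k x
  proof -
    obtain \<theta> where "f (x + t k *\<^sub>R v) - f (x + 0 *\<^sub>R v) = (t k - 0) * D (x + \<theta> *\<^sub>R v) v"
      using MVT2[OF t(1)[of k] line, of x] by blast
    then have "q k x = D (x + \<theta> *\<^sub>R v) v"
      using t(1)[of k] by (simp add: q_def add.commute)
    then show ?thesis using B' by simp
  qed
  have q_0: "q k x = 0" if "x \<notin> cball 0 (R + norm v)" for k x
  proof -
    have n: "norm x > R + norm v" using that by simp
    have "x \<notin> K" using R(2)[of x] n norm_ge_zero[of v] by linarith
    moreover have "t k *\<^sub>R v + x \<notin> K"
    proof
      assume "t k *\<^sub>R v + x \<in> K"
      then have "norm (t k *\<^sub>R v + x) \<le> R" by (rule R(2))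
      moreover have "norm x \<le> norm (t k *\<^sub>R v + x) + norm (t k *\<^sub>R v)"
        using norm_triangle_ineq4[of "t k *\<^sub>R v + x" "t k *\<^sub>R v"] by simp
      moreover have "norm (t k *\<^sub>R v) \<le> norm v"
        using t[of k] by (simp add: mult_left_le_one_le)
      ultimately show False using n by simp
    qed
    ultimately show ?thesis by (simp add: q_def K(2))
  qed
  have int_shift: "integrable lborel (\<lambda>x. f (t k *\<^sub>R v + x))"
    "(LINT x|lborel. f (t k *\<^sub>R v + x)) = (LINT x|lborel. f x)" for k
  proof -
    have m: "(+) (t k *\<^sub>R v) \<in> measurable lborel borel" "f \<in> borel_measurable borel"
      by (simp_all add: borel_measurable_continuous_onI contf)
    show "integrable lborel (\<lambda>x. f (t k *\<^sub>R v + x))"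
      using integrable_distr_eq[OF m] int_f by (simp add: lborel_distr_plus)
    show "(LINT x|lborel. f (t k *\<^sub>R v + x)) = (LINT x|lborel. f x)"
      using integral_distr[OF m] by (simp add: lborel_distr_plus)
  qed
  have "(\<lambda>k. LINT x|lborel. q k x) \<longlonglongrightarrow> (LINT x|lborel. D x v)"
  proof (rule integral_dominated_convergence[where w="\<lambda>x. indicator (cball 0 (R + norm v)) x *\<^sub>R B"])
    show "(\<lambda>x. D x v) \<in> borel_measurable lborel"
      using cont by (simp add: borel_measurable_continuous_onI)
    show "q k \<in> borel_measurable lborel" for k
      unfolding q_def using int_shift(1)[of k] int_f by simp
    show "integrable lborel (\<lambda>x. indicator (cball 0 (R + norm v)) x *\<^sub>R B)"
      by (intro borel_integrable_compact) auto
    show "AE x in lborel. norm (q k x) \<le> indicator (cball 0 (R + norm v)) x *\<^sub>R B" for k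
      using q_bound q_0 by (intro AE_I2) (auto simp: indicator_def)
    show "AE x in lborel. (\<lambda>k. q k x) \<longlonglongrightarrow> D x v"
    proof (rule AE_I2)
      fix x
      have "((\<lambda>h. (f (x + (0 + h) *\<^sub>R v) - f (x + 0 *\<^sub>R v)) / h) \<longlongrightarrow> D (x + 0 *\<^sub>R v) v) (at 0)"
        using line[of x 0] unfolding DERIV_def .
      moreover have "filterlim t (at 0) sequentially"
        using t_lim t(1) by (auto simp: filterlim_at eventually_sequentially less_imp_neq[symmetric])
      ultimately show "(\<lambda>k. q k x) \<longlonglongrightarrow> D x v"
        unfolding q_def using filterlim_compose by (force simp: add.commute)
    qed
  qed
  moreover have "(LINT x|lborel. q k x) = 0" for k
    unfolding q_def using int_shift[of k] int_f by simp
  ultimately have "(LINT x|lborel. D x v) = 0"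
    using LIMSEQ_unique[OF _ tendsto_const[of 0]] by simp
  then show ?thesis
    using cont by (subst integral_completion) (auto simp: borel_measurable_continuous_onI)
qed

lemma integral_div_field_eq_0:
  assumes "smooth \<xi>" "compact (closure {x. \<xi> x \<noteq> 0})"
  shows "(LINT x|lebesgue. div_field \<xi> x) = 0"
proof -
  let ?K = "closure {x. \<xi> x \<noteq> 0}"
  have out: "\<xi> x \<bullet> b = 0" "frechet_derivative \<xi> (at x) b \<bullet> b = 0" if "x \<notin> ?K" for x b
  proof -
    have "x \<notin> {x. \<xi> x \<noteq> 0}" using closure_subset that by (rule contra_subsetD)
    then show "\<xi> x \<bullet> b = 0" by simp
    show "frechet_derivative \<xi> (at x) b \<bullet> b = 0"
      by (subst frechet_derivative_eq_0_outside_support[OF that]) (rule inner_zero_left)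
  qed
  have cont: "continuous_on UNIV (\<lambda>x. frechet_derivative \<xi> (at x) b \<bullet> b)" for b
    by (intro continuous_intros smooth_imp_continuous[OF smooth_frechet_derivative] assms)
  have "integrable lebesgue (\<lambda>x. frechet_derivative \<xi> (at x) b \<bullet> b)" for b
    by (rule integrable_continuous_compact_support(2)[OF cont assms(2)])
       (rule out(2))
  then have "(LINT x|lebesgue. div_field \<xi> x)
      = (\<Sum>b\<in>Basis. LINT x|lebesgue. frechet_derivative \<xi> (at x) b \<bullet> b)"
    unfolding div_field_def by (rule Bochner_Integration.integral_sum)
  also have "\<dots> = 0"
  proof (rule sum.neutral, rule ballI)
    fix b
    have D: "((\<lambda>x. \<xi> x \<bullet> b) has_derivative (\<lambda>h. frechet_derivative \<xi> (at x) h \<bullet> b)) (at x)" for x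
      by (rule has_derivative_inner_left[OF smooth_has_derivative[OF assms(1)]])
    show "(LINT x|lebesgue. frechet_derivative \<xi> (at x) b \<bullet> b) = 0"
      by (rule integral_directional_derivative_eq_0[OF D cont assms(2) out])
  qed
  finally show ?thesis .
qed

text \<open>
  Since a test field has total divergence \<open>0\<close>, its divergence over \<open>C - E\<close> is that of the opposite field
  over \<open>E\<close>.
\<close>

lemma rel_perimeter_complement_le:
  assumes "E \<subseteq> C" "E \<in> sets lebesgue"
  shows "rel_perimeter C (C - E) \<le> rel_perimeter C E"
proof (rule rel_perimeter_least)
  fix \<xi> assume \<xi>: "\<xi> \<in> test_fields C"
  note \<xi>D = test_fieldsD[OF \<xi>]
  let ?\<eta> = "\<lambda>x. (-1) *\<^sub>R \<xi> x"
  have \<eta>: "?\<eta> \<in> test_fields C"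
    by (rule test_fields_scaleR[OF \<xi> smooth_const]) simp
  have div_\<eta>: "div_field ?\<eta> x = - div_field \<xi> x" for x
    using div_field_scaleR[OF smooth_const \<xi>D(1), of "-1" x] by simp
  have int: "integrable lebesgue (div_field \<xi>)"
    by (rule integrable_div_field[OF \<xi>D(1,2)])
  have "indicator (C - E) x * div_field \<xi> x = div_field \<xi> x - indicator E x * div_field \<xi> x" for x
    using assms(1) \<xi>D(3) interior_subset[of C] div_field_eq_0_outside_support[of x \<xi>]
    by (auto simp: indicator_def)
  then have "(LINT x:C - E|lebesgue. div_field \<xi> x)
      = (LINT x|lebesgue. div_field \<xi> x - indicator E x *\<^sub>R div_field \<xi> x)"
    by (simp add: set_lebesgue_integral_def)
  also have "\<dots> = (LINT x|lebesgue. div_field \<xi> x) - (LINT x|lebesgue. indicator E x *\<^sub>R div_field \<xi> x)"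
    by (rule Bochner_Integration.integral_diff[OF int integrable_mult_indicator[OF assms(2) int]])
  also have "\<dots> = (LINT x:E|lebesgue. div_field ?\<eta> x)"
    using integral_div_field_eq_0[OF \<xi>D(1,2)]
    unfolding div_\<eta> by (simp add: set_lebesgue_integral_def)
  finally show "ereal (LINT x:C - E|lebesgue. div_field \<xi> x) \<le> rel_perimeter C E"
    using rel_perimeter_upper[OF \<eta>, of E] by simp
qed

lemma rel_perimeter_self: "rel_perimeter C C = 0"
proof (rule antisym[OF _ rel_perimeter_nonneg])
  show "rel_perimeter C C \<le> 0"
    using rel_perimeter_complement_le[of "{}" C] by (simp add: rel_perimeter_empty)
qed

section \<open>Adjusting the volume\<close>

text \<open>
  The volume that a ball cuts out of \<open>E\<close> depends continuously on the radius, as it changes by no more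
  than the volume of the ball does; the intermediate value theorem does the rest.
\<close>

lemma ball_cuts_given_volume:
  fixes E :: "'a::euclidean_space set"
  assumes E: "E \<in> lmeasurable" and h: "0 < h"
    and v: "0 \<le> v" "v \<le> measure lebesgue (E \<inter> cball x0 h)"
  obtains r where "0 \<le> r" "r \<le> h" "measure lebesgue (E \<inter> cball x0 r) = v"
proof -
  define m where "m r = measure lebesgue (E \<inter> cball x0 r)" for r
  define w where "w r = unit_ball_vol DIM('a) * r ^ DIM('a)" for r
  have mE: "E \<inter> cball x0 r \<in> lmeasurable" for r
    using E by (rule fmeasurable_Int_fmeasurable) simp
  have incr: "\<bar>m s - m r\<bar> \<le> \<bar>w s - w r\<bar>" if "0 \<le> r" "r \<le> s" for r s
  proof -
    have 1: "m s - m r = measure lebesgue (E \<inter> cball x0 s - E \<inter> cball x0 r)"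
      unfolding m_def using that mE by (intro measurable_measure_Diff[symmetric]) auto
    have "measure lebesgue (E \<inter> cball x0 s - E \<inter> cball x0 r) \<le> measure lebesgue (cball x0 s - cball x0 r)"
      using mE by (intro measure_mono_fmeasurable fmeasurable_Diff sets.Diff) auto
    also have "\<dots> = measure lebesgue (cball x0 s) - measure lebesgue (cball x0 r)"
      using that by (intro measurable_measure_Diff) auto
    also have "\<dots> = w s - w r"
      using that by (simp add: content_cball w_def)
    finally show ?thesis using 1 by simp
  qed
  have "continuous_on {0..h} m"
    unfolding continuous_on_def
  proof
    fix r assume r: "r \<in> {0..h}"
    have le: "\<bar>m s - m r\<bar> \<le> \<bar>w s - w r\<bar>" if "s \<in> {0..h}" for s
      using incr[of r s] incr[of s r] r that by (cases "r \<le> s") (auto simp: abs_minus_commute)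
    have "continuous_on {0..h} w" unfolding w_def by (intro continuous_intros)
    then have "((\<lambda>s. \<bar>w s - w r\<bar>) \<longlongrightarrow> 0) (at r within {0..h})"
      using r by (auto simp: continuous_on_def tendsto_rabs_zero_iff LIM_zero_iff)
    then have "((\<lambda>s. m s - m r) \<longlongrightarrow> 0) (at r within {0..h})"
      by (rule Lim_null_comparison[rotated]) (auto simp: eventually_at_filter le)
    then show "(m \<longlongrightarrow> m r) (at r within {0..h})"
      by (simp add: LIM_zero_iff)
  qed
  moreover have "m 0 = 0"
  proof -
    have "m 0 \<le> measure lebesgue (cball x0 0)"
      unfolding m_def by (rule measure_mono_fmeasurable[OF _ fmeasurableD[OF mE]]) (blast, rule lmeasurable_cball)
    then show ?thesis by (simp add: m_def measure_le_0_iff)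
  qed
  ultimately obtain r where "r \<ge> 0" "r \<le> h" "m r = v"
    using IVT'[of m 0 v h] v h by (auto simp: m_def)
  then show ?thesis using that by (simp add: m_def)
qed

text \<open>
  The number \<open>N\<close> exceeds the number of balls of radius \<open>h\<close> that cover \<open>cball 0 R\<close>. If each of them met \<open>E\<close>
  in less than the excess volume, then \<open>E\<close> would have less than \<open>N\<close> times the excess. That \<open>N\<close> depends only
  on \<open>R\<close> and \<open>\<epsilon>\<close>, and not on \<open>C\<close> or \<open>E\<close>, makes the estimate uniform along a sequence of bodies.
\<close>

lemma volume_fixing_below:
  fixes R \<epsilon> :: real
  assumes dim: "DIM('a::euclidean_space) \<ge> 2" and \<epsilon>: "\<epsilon> > 0"
  obtains N where "N \<ge> 1"
    "\<And>C E v. (E::'a set) \<in> sets lebesgue \<Longrightarrow> E \<subseteq> cball 0 R \<Longrightarrow> 0 \<le> v \<Longrightarrow> v \<le> measure lebesgue E \<Longrightarrow>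
      N * (measure lebesgue E - v) \<le> measure lebesgue E \<Longrightarrow>
      \<exists>E'\<subseteq>E. E' \<in> sets lebesgue \<and> measure lebesgue E' = v
        \<and> rel_perimeter C E' \<le> rel_perimeter C E + ereal \<epsilon>"
proof -
  obtain K where K: "K \<ge> 0"
    "\<And>C E (x0::'a) r h. (E::'a set) \<in> sets lebesgue \<Longrightarrow> 0 \<le> r \<Longrightarrow> r \<le> h \<Longrightarrow> 0 < h \<Longrightarrow>
      rel_perimeter C (E - cball x0 r) \<le> rel_perimeter C E + ereal (K * h ^ (DIM('a) - 1))"
    by (rule rel_perimeter_Diff_cball) blast
  \<comment> \<open>As \<open>h \<le> 1\<close> and \<open>d - 1 \<ge> 1\<close>, the cost \<open>K h ^ (d - 1)\<close> is at most \<open>K h\<close>.\<close>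
  define h where "h = min 1 (\<epsilon> / (K + 1))"
  have h: "0 < h" "h \<le> 1" "K * h \<le> \<epsilon>"
  proof -
    show "0 < h" "h \<le> 1" using K(1) \<epsilon> by (auto simp: h_def)
    have "K * h \<le> K * (\<epsilon> / (K + 1))"
      using K(1) by (intro mult_left_mono) (auto simp: h_def)
    also have "\<dots> \<le> \<epsilon>" using K(1) \<epsilon> by (simp add: divide_simps algebra_simps)
    finally show "K * h \<le> \<epsilon>" .
  qed
  have "h ^ (DIM('a) - 1) \<le> h ^ 1"
    using h dim by (intro power_decreasing) auto
  then have Kh: "K * h ^ (DIM('a) - 1) \<le> \<epsilon>"
    using mult_left_mono[OF _ K(1)] h(3) by fastforce
  have "compact (cball 0 R :: 'a set)" by simp
  then obtain X :: "'a set" where X: "finite X" "cball 0 R \<subseteq> (\<Union>x\<in>X. ball x h)"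
    using h(1) unfolding compact_eq_totally_bounded by meson
  define N where "N = real (card X) + 1"
  show ?thesis
  proof (rule that[of N])
    show "N \<ge> 1" by (simp add: N_def)
    fix C E :: "'a set" and v :: real
    assume E: "E \<in> sets lebesgue" "E \<subseteq> cball 0 R" and v: "0 \<le> v" "v \<le> measure lebesgue E"
      and N: "N * (measure lebesgue E - v) \<le> measure lebesgue E"
    let ?m = "measure lebesgue"
    have lE: "E \<in> lmeasurable" using fmeasurableI2[OF _ E(2,1)] by simp
    have "\<exists>x0. ?m E - v \<le> ?m (E \<inter> cball x0 h)"
    proof (rule ccontr)
      assume "\<nexists>x0. ?m E - v \<le> ?m (E \<inter> cball x0 h)"
      then have small: "?m (E \<inter> cball x h) < ?m E - v" for x by (auto simp: not_le)
      have pos: "?m E - v > 0" using small[of 0] measure_nonneg[of lebesgue "E \<inter> cball 0 h"] by linarith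
      have "(\<Union>x\<in>X. ball x h) \<subseteq> (\<Union>x\<in>X. cball x h)"
        by (intro UN_mono ball_subset_cball subset_refl)
      then have "E \<subseteq> (\<Union>x\<in>X. cball x h)"
        using E(2) X(2) by (meson subset_trans)
      then have "E = (\<Union>x\<in>X. E \<inter> cball x h)"
        by (simp flip: Int_UN_distrib add: inf.absorb1)
      then have "?m E = ?m (\<Union>x\<in>X. E \<inter> cball x h)" by simp
      also have "\<dots> \<le> (\<Sum>x\<in>X. ?m (E \<inter> cball x h))"
        using X(1) E(1) by (intro measure_UNION_le) auto
      also have "\<dots> \<le> real (card X) * (?m E - v)"
        using sum_bounded_above[of X "\<lambda>x. ?m (E \<inter> cball x h)" "?m E - v"] small by (simp add: less_imp_le)
      also have "\<dots> < N * (?m E - v)" using pos by (simp add: N_def)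
      finally show False using N by simp
    qed
    then obtain x0 where "?m E - v \<le> ?m (E \<inter> cball x0 h)" by blast
    then obtain r where r: "0 \<le> r" "r \<le> h" "?m (E \<inter> cball x0 r) = ?m E - v"
      using ball_cuts_given_volume[OF lE h(1), of "?m E - v" x0] v by auto
    have "?m (E - E \<inter> cball x0 r) = ?m E - ?m (E \<inter> cball x0 r)"
      by (rule measurable_measure_Diff[OF lE]) (use E(1) in auto)
    then have "?m (E - cball x0 r) = v" using r(3) by (simp add: Diff_Int)
    moreover have "rel_perimeter C (E - cball x0 r) \<le> rel_perimeter C E + ereal \<epsilon>"
      by (rule order_trans[OF K(2)[OF E(1) r(1,2) h(1)]]) (use Kh in \<open>intro add_left_mono, simp\<close>)
    ultimately show "\<exists>E'\<subseteq>E. E' \<in> sets lebesgue \<and> ?m E' = v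
        \<and> rel_perimeter C E' \<le> rel_perimeter C E + ereal \<epsilon>"
      using E(1) by (intro exI[of _ "E - cball x0 r"]) auto
  qed
qed

text \<open>
  A deficit of volume is repaired by removing a ball from the complement. Hence the error has to be
  small compared with the target volume \<open>v\<close> and with \<open>|C| - v\<close>.
\<close>

lemma volume_fixing:
  fixes R \<epsilon> :: real
  assumes dim: "DIM('a::euclidean_space) \<ge> 2" and \<epsilon>: "\<epsilon> > 0"
  obtains N where "N \<ge> 1"
    "\<And>C E v. (C::'a set) \<in> lmeasurable \<Longrightarrow> C \<subseteq> cball 0 R \<Longrightarrow> E \<in> sets lebesgue \<Longrightarrow> E \<subseteq> C \<Longrightarrow>
      0 \<le> v \<Longrightarrow> v \<le> measure lebesgue C \<Longrightarrow>
      N * \<bar>measure lebesgue E - v\<bar> \<le> v \<Longrightarrow> N * \<bar>measure lebesgue E - v\<bar> \<le> measure lebesgue C - v \<Longrightarrow>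
      \<exists>E'\<subseteq>C. E' \<in> sets lebesgue \<and> measure lebesgue E' = v
        \<and> rel_perimeter C E' \<le> rel_perimeter C E + ereal \<epsilon>"
proof -
  obtain N where N: "N \<ge> 1"
    "\<And>C E v. (E::'a set) \<in> sets lebesgue \<Longrightarrow> E \<subseteq> cball 0 R \<Longrightarrow> 0 \<le> v \<Longrightarrow> v \<le> measure lebesgue E \<Longrightarrow>
      N * (measure lebesgue E - v) \<le> measure lebesgue E \<Longrightarrow>
      \<exists>E'\<subseteq>E. E' \<in> sets lebesgue \<and> measure lebesgue E' = v
        \<and> rel_perimeter C E' \<le> rel_perimeter C E + ereal \<epsilon>"
    by (rule volume_fixing_below[OF dim \<epsilon>, where R=R]) blast
  show ?thesis
  proof (rule that[OF N(1)])
    let ?m = "measure lebesgue :: 'a set \<Rightarrow> real"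
    fix C E :: "'a set" and v :: real
    assume C: "C \<in> lmeasurable" "C \<subseteq> cball 0 R" and E: "E \<in> sets lebesgue" "E \<subseteq> C"
      and v: "0 \<le> v" "v \<le> ?m C" and Nv: "N * \<bar>?m E - v\<bar> \<le> v" "N * \<bar>?m E - v\<bar> \<le> ?m C - v"
    have Cs: "C \<in> sets lebesgue" using C(1) by (rule fmeasurableD)
    have diff: "?m (C - F) = ?m C - ?m F" if "F \<in> sets lebesgue" "F \<subseteq> C" for F
      using that C(1) by (intro measurable_measure_Diff) auto
    show "\<exists>E'\<subseteq>C. E' \<in> sets lebesgue \<and> ?m E' = v \<and> rel_perimeter C E' \<le> rel_perimeter C E + ereal \<epsilon>"
    proof (cases "v \<le> ?m E")
      case True
      have "N * (?m E - v) \<le> ?m E" using Nv(1) True by simp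
      then obtain E' where "E' \<subseteq> E" "E' \<in> sets lebesgue" "?m E' = v"
          "rel_perimeter C E' \<le> rel_perimeter C E + ereal \<epsilon>"
        using N(2)[OF E(1) subset_trans[OF E(2) C(2)] v(1) True] by blast
      then show ?thesis using E(2) by (intro exI[of _ E']) auto
    next
      case False
      have F: "C - E \<in> sets lebesgue" "C - E \<subseteq> cball 0 R"
        using Cs E C(2) by auto
      have "N * (?m (C - E) - (?m C - v)) \<le> ?m (C - E)"
        using Nv(2) False diff[OF E] by simp
      moreover have "0 \<le> ?m C - v" "?m C - v \<le> ?m (C - E)"
        using v False diff[OF E] by auto
      ultimately obtain F' where F': "F' \<subseteq> C - E" "F' \<in> sets lebesgue" "?m F' = ?m C - v"
          "rel_perimeter C F' \<le> rel_perimeter C (C - E) + ereal \<epsilon>"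
        using N(2)[OF F, of "?m C - v" C] by blast
      have "F' \<subseteq> C" using F'(1) by blast
      have "rel_perimeter C (C - F') \<le> rel_perimeter C F'"
        by (rule rel_perimeter_complement_le[OF \<open>F' \<subseteq> C\<close> F'(2)])
      also have "\<dots> \<le> rel_perimeter C (C - E) + ereal \<epsilon>" by (rule F'(4))
      also have "\<dots> \<le> rel_perimeter C E + ereal \<epsilon>"
        by (intro add_right_mono rel_perimeter_complement_le E)
      finally have "rel_perimeter C (C - F') \<le> rel_perimeter C E + ereal \<epsilon>" .
      moreover have "?m (C - F') = v"
        using diff[OF F'(2) \<open>F' \<subseteq> C\<close>] F'(3) by simp
      ultimately show ?thesis
        using Cs F'(2) by (intro exI[of _ "C - F'"]) auto
    qed
  qed
qed

section \<open>Comparison of profiles\<close>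

lemma iso_profile_lower:
  "E \<subseteq> C \<Longrightarrow> E \<in> sets lebesgue \<Longrightarrow> iso_profile C (measure lebesgue E) \<le> rel_perimeter C E"
  unfolding iso_profile_def by (rule INF_lower) simp

lemma iso_profile_nonneg: "0 \<le> iso_profile C v"
  unfolding iso_profile_def by (intro INF_greatest rel_perimeter_nonneg)

text \<open>
  Test fields of \<open>D\<close> are test fields of \<open>C\<close>, and their divergence does not see the part of \<open>E\<close> outside \<open>D\<close>.
\<close>

lemma rel_perimeter_restrict:
  assumes "D \<subseteq> C"
  shows "rel_perimeter D (E \<inter> D) \<le> rel_perimeter C E"
proof (rule rel_perimeter_least)
  fix \<xi> assume \<xi>: "\<xi> \<in> test_fields D"
  note \<xi>D = test_fieldsD[OF \<xi>]
  have "\<xi> \<in> test_fields C"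
    using \<xi> interior_mono[OF assms] by (auto simp: test_fields_def)
  moreover have "(LINT x:E \<inter> D|lebesgue. div_field \<xi> x) = (LINT x:E|lebesgue. div_field \<xi> x)"
  proof -
    have "indicator (E \<inter> D) x * div_field \<xi> x = indicator E x * div_field \<xi> x" for x
      using \<xi>D(3) interior_subset[of D] div_field_eq_0_outside_support[of x \<xi>]
      by (auto simp: indicator_def)
    then show ?thesis
      by (simp only: set_lebesgue_integral_def real_scaleR_def)
  qed
  ultimately show "ereal (LINT x:E \<inter> D|lebesgue. div_field \<xi> x) \<le> rel_perimeter C E"
    using rel_perimeter_upper[of \<xi> C E] by simp
qed

text \<open>
  If \<open>E\<close> is a fraction \<open>s\<close> of \<open>C\<close>, then the volume of \<open>E \<inter> D\<close> differs from \<open>s |D|\<close> by at most \<open>|C| - |D|\<close>. The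
  constant \<open>\<kappa>\<close> makes this error small enough to be repaired inside \<open>D\<close>; it is positive because \<open>s\<close> is
  neither \<open>0\<close> nor \<open>1\<close>.
\<close>

lemma iso_profile_subdomain:
  fixes R \<epsilon> s :: real
  assumes dim: "DIM('a::euclidean_space) \<ge> 2" and \<epsilon>: "\<epsilon> > 0" and s: "0 < s" "s < 1"
  obtains \<kappa> where "\<kappa> > 0"
    "\<And>C D. (C::'a set) \<in> lmeasurable \<Longrightarrow> D \<in> lmeasurable \<Longrightarrow> D \<subseteq> C \<Longrightarrow> C \<subseteq> cball 0 R \<Longrightarrow>
      measure lebesgue C \<le> (1 + \<kappa>) * measure lebesgue D \<Longrightarrow>
      iso_profile D (s * measure lebesgue D) \<le> iso_profile C (s * measure lebesgue C) + ereal \<epsilon>"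
proof -
  let ?m = "measure lebesgue :: 'a set \<Rightarrow> real"
  obtain N where N: "N \<ge> 1"
    "\<And>C E v. (C::'a set) \<in> lmeasurable \<Longrightarrow> C \<subseteq> cball 0 R \<Longrightarrow> E \<in> sets lebesgue \<Longrightarrow> E \<subseteq> C \<Longrightarrow>
      0 \<le> v \<Longrightarrow> v \<le> ?m C \<Longrightarrow> N * \<bar>?m E - v\<bar> \<le> v \<Longrightarrow> N * \<bar>?m E - v\<bar> \<le> ?m C - v \<Longrightarrow>
      \<exists>E'\<subseteq>C. E' \<in> sets lebesgue \<and> ?m E' = v
        \<and> rel_perimeter C E' \<le> rel_perimeter C E + ereal \<epsilon>"
    by (rule volume_fixing[OF dim \<epsilon>, where R=R]) blast
  define \<kappa> where "\<kappa> = min s (1 - s) / N"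
  have \<kappa>: "\<kappa> > 0" "N * \<kappa> \<le> s" "N * \<kappa> \<le> 1 - s"
    using N(1) s by (auto simp: \<kappa>_def)
  show ?thesis
  proof (rule that[OF \<kappa>(1)])
    fix C D :: "'a set"
    assume C: "C \<in> lmeasurable" and D: "D \<in> lmeasurable" and sub: "D \<subseteq> C" "C \<subseteq> cball 0 R"
      and vol: "?m C \<le> (1 + \<kappa>) * ?m D"
    have mCD: "?m (C - D) = ?m C - ?m D" and le: "?m D \<le> ?m C"
      using C D sub(1) by (auto intro!: measurable_measure_Diff measure_mono_fmeasurable)
    have mD: "0 \<le> ?m D" by simp
    have Ds: "D \<in> sets lebesgue" using D by (rule fmeasurableD)
    have *: "iso_profile D (s * ?m D) \<le> rel_perimeter C E + ereal \<epsilon>"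
      if E: "E \<subseteq> C" "E \<in> sets lebesgue" "?m E = s * ?m C" for E
    proof -
      define \<delta> where "\<delta> = ?m C - ?m D"
      have \<delta>: "0 \<le> \<delta>" "N * \<delta> \<le> s * ?m D" "N * \<delta> \<le> (1 - s) * ?m D" "0 \<le> s * \<delta>" "0 \<le> (1 - s) * \<delta>"
      proof -
        show "0 \<le> \<delta>" using le by (simp add: \<delta>_def)
        then show "0 \<le> s * \<delta>" "0 \<le> (1 - s) * \<delta>" using s by auto
        have "N * \<delta> \<le> N * (\<kappa> * ?m D)"
          using vol N(1) by (intro mult_left_mono) (auto simp: \<delta>_def algebra_simps)
        then have Nd: "N * \<delta> \<le> (N * \<kappa>) * ?m D" by simp
        show "N * \<delta> \<le> s * ?m D"
          using Nd mult_right_mono[OF \<kappa>(2) mD] by linarith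
        show "N * \<delta> \<le> (1 - s) * ?m D"
          using Nd mult_right_mono[OF \<kappa>(3) mD] by linarith
      qed
      have lE: "E \<in> lmeasurable" using E C by (auto intro: fmeasurableI2[OF C])
      have EDs: "E \<inter> D \<in> sets lebesgue" using E(2) Ds by auto
      have up: "?m (E \<inter> D) \<le> ?m E"
        using EDs lE by (intro measure_mono_fmeasurable) auto
      have low: "?m E \<le> ?m (E \<inter> D) + \<delta>"
      proof -
        have "?m (E - E \<inter> D) = ?m E - ?m (E \<inter> D)"
          by (rule measurable_measure_Diff[OF lE EDs]) auto
        moreover have "?m (E - E \<inter> D) \<le> ?m (C - D)"
          using E(1,2) EDs C D by (intro measure_mono_fmeasurable fmeasurable_Diff) auto
        ultimately show ?thesis by (simp add: mCD \<delta>_def)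
      qed
      have eq: "s * ?m C = s * ?m D + s * \<delta>" by (simp add: \<delta>_def algebra_simps)
      have "\<bar>?m (E \<inter> D) - s * ?m D\<bar> \<le> \<delta>"
      proof -
        have "s * \<delta> + (1 - s) * \<delta> = \<delta>" by (simp add: algebra_simps)
        then show ?thesis using up low E(3) eq \<delta>(4,5) by linarith
      qed
      then have Nw: "N * \<bar>?m (E \<inter> D) - s * ?m D\<bar> \<le> N * \<delta>"
        using N(1) by (intro mult_left_mono) auto
      have "(1 - s) * ?m D = ?m D - s * ?m D" by (simp add: algebra_simps)
      then have 1: "N * \<bar>?m (E \<inter> D) - s * ?m D\<bar> \<le> s * ?m D"
          "N * \<bar>?m (E \<inter> D) - s * ?m D\<bar> \<le> ?m D - s * ?m D"
        using Nw \<delta>(2,3) by linarith+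
      have 2: "0 \<le> s * ?m D" "s * ?m D \<le> ?m D"
        using s mD by (auto intro: mult_left_le_one_le)
      obtain E' where E': "E' \<subseteq> D" "E' \<in> sets lebesgue" "?m E' = s * ?m D"
          "rel_perimeter D E' \<le> rel_perimeter D (E \<inter> D) + ereal \<epsilon>"
        using N(2)[OF D subset_trans[OF sub] EDs Int_lower2 2 1] by blast
      have "iso_profile D (s * ?m D) \<le> rel_perimeter D E'"
        using iso_profile_lower[OF E'(1,2)] E'(3) by simp
      also have "\<dots> \<le> rel_perimeter D (E \<inter> D) + ereal \<epsilon>" by (rule E'(4))
      also have "\<dots> \<le> rel_perimeter C E + ereal \<epsilon>"
        by (intro add_right_mono rel_perimeter_restrict sub)
      finally show ?thesis .
    qed
    have "iso_profile D (s * ?m D) - ereal \<epsilon> \<le> iso_profile C (s * ?m C)"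
      unfolding iso_profile_def[of C] using * by (intro INF_greatest) (simp add: ereal_minus_le)
    then show "iso_profile D (s * ?m D) \<le> iso_profile C (s * ?m C) + ereal \<epsilon>"
      by (simp add: ereal_minus_le)
  qed
qed

section \<open>Homotheties\<close>

lemma homothety_inverse:
  fixes t :: real and a :: "'a::real_vector"
  assumes "t \<noteq> 0"
  shows "(1 / t) *\<^sub>R (t *\<^sub>R x + a) - (1 / t) *\<^sub>R a = x"
    and "t *\<^sub>R ((1 / t) *\<^sub>R x - (1 / t) *\<^sub>R a) + a = x"
  using assms by (simp_all add: algebra_simps)

lemma lebesgue_measurable_homothety:
  fixes a :: "'a::euclidean_space"
  assumes "t \<noteq> 0"
  shows "(\<lambda>x. t *\<^sub>R x + a) \<in> lebesgue \<rightarrow>\<^sub>M lebesgue"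
    and "lebesgue = density (distr lebesgue lebesgue (\<lambda>x. t *\<^sub>R x + a)) (\<lambda>_. \<bar>t\<bar> ^ DIM('a))"
proof -
  have eq: "(\<lambda>x. a + (\<Sum>j\<in>Basis. (t * (x \<bullet> j)) *\<^sub>R j)) = (\<lambda>x. t *\<^sub>R x + a)"
    unfolding scaleR_scaleR[symmetric] scaleR_sum_right[symmetric]
    by (simp add: euclidean_representation add.commute)
  show "(\<lambda>x. t *\<^sub>R x + a) \<in> lebesgue \<rightarrow>\<^sub>M lebesgue"
    using lebesgue_affine_measurable[of "\<lambda>_. t" a] assms unfolding eq by simp
  show "lebesgue = density (distr lebesgue lebesgue (\<lambda>x. t *\<^sub>R x + a)) (\<lambda>_. \<bar>t\<bar> ^ DIM('a))"
    using lebesgue_affine_euclidean[of "\<lambda>_. t" a] assms unfolding eq by (simp add: ennreal_power)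
qed

lemma lebesgue_integral_homothety:
  fixes f :: "'a::euclidean_space \<Rightarrow> real"
  assumes t: "0 < t" and f: "f \<in> borel_measurable lebesgue"
  shows "(LINT x|lebesgue. f x) = t ^ DIM('a) * (LINT x|lebesgue. f (t *\<^sub>R x + a))"
proof -
  let ?T = "\<lambda>x. t *\<^sub>R x + a"
  have T: "?T \<in> lebesgue \<rightarrow>\<^sub>M lebesgue"
    using t by (intro lebesgue_measurable_homothety) auto
  have "(LINT x|lebesgue. f x)
      = integral\<^sup>L (density (distr lebesgue lebesgue ?T) (\<lambda>_. ennreal (t ^ DIM('a)))) f"
    using lebesgue_measurable_homothety(2)[of t a] t by simp
  also have "\<dots> = integral\<^sup>L (distr lebesgue lebesgue ?T) (\<lambda>x. t ^ DIM('a) *\<^sub>R f x)"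
    using t f by (intro integral_density) auto
  also have "\<dots> = (LINT x|lebesgue. t ^ DIM('a) *\<^sub>R f (?T x))"
    using f by (intro integral_distr[OF T]) auto
  finally show ?thesis by simp
qed

lemma sets_lebesgue_homothety:
  fixes a :: "'a::euclidean_space"
  assumes t: "t \<noteq> 0" and E: "E \<in> sets lebesgue"
  shows "(\<lambda>x. t *\<^sub>R x + a) ` E \<in> sets lebesgue"
proof -
  let ?S = "\<lambda>x. (1 / t) *\<^sub>R x + (- (1 / t)) *\<^sub>R a"
  have "?S -` E \<inter> space lebesgue \<in> sets lebesgue"
    using t by (intro measurable_sets[OF lebesgue_measurable_homothety(1) E]) auto
  moreover have "?S -` E \<inter> space lebesgue = (\<lambda>x. t *\<^sub>R x + a) ` E"
  proof (intro set_eqI iffI)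
    fix x assume "x \<in> ?S -` E \<inter> space lebesgue"
    then show "x \<in> (\<lambda>x. t *\<^sub>R x + a) ` E"
      using homothety_inverse(2)[OF t, of x a] by (intro image_eqI[of _ _ "?S x"]) auto
  next
    fix x assume "x \<in> (\<lambda>x. t *\<^sub>R x + a) ` E"
    then show "x \<in> ?S -` E \<inter> space lebesgue"
      using homothety_inverse(1)[OF t, of _ a] by auto
  qed
  ultimately show ?thesis by simp
qed

lemma div_field_homothety:
  assumes "smooth \<xi>"
  shows "div_field (\<lambda>x. \<xi> (t *\<^sub>R x + a)) x = t * div_field \<xi> (t *\<^sub>R x + a)"
proof -
  let ?D = "frechet_derivative \<xi> (at (t *\<^sub>R x + a))"
  have "((\<lambda>x. \<xi> (t *\<^sub>R x + a)) has_derivative (\<lambda>h. ?D (t *\<^sub>R h))) (at x)"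
    by (rule has_derivative_compose[OF _ smooth_has_derivative[OF assms]])
       (auto intro!: derivative_eq_intros)
  note D = frechet_derivative_at[OF this, symmetric]
  have "linear ?D"
    using smooth_has_derivative[OF assms] by (rule has_derivative_linear)
  then show ?thesis
    by (simp add: div_field_def D linear_scale sum_distrib_left)
qed

lemma test_fields_homothety:
  fixes a :: "'a::euclidean_space"
  assumes t: "t > 0" and \<xi>: "\<xi> \<in> test_fields ((\<lambda>x. t *\<^sub>R x + a) ` C)"
  shows "(\<lambda>x. \<xi> (t *\<^sub>R x + a)) \<in> test_fields C"
proof -
  let ?T = "\<lambda>x. t *\<^sub>R x + a" and ?S = "\<lambda>x. (1 / t) *\<^sub>R x - (1 / t) *\<^sub>R a"
  let ?K = "closure {x. \<xi> x \<noteq> 0}" and ?L = "closure {x. \<xi> (?T x) \<noteq> 0}"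
  note \<xi>D = test_fieldsD[OF \<xi>]
  have t0: "t \<noteq> 0" using t by simp
  have "compact (?S ` ?K)"
    by (intro compact_continuous_image \<xi>D(2) continuous_intros)
  moreover have "{x. \<xi> (?T x) \<noteq> 0} \<subseteq> ?S ` ?K"
  proof
    fix x assume "x \<in> {x. \<xi> (?T x) \<noteq> 0}"
    then have "?T x \<in> ?K" using closure_subset[of "{x. \<xi> x \<noteq> 0}"] by auto
    from imageI[OF this, of ?S] show "x \<in> ?S ` ?K"
      by (simp only: homothety_inverse(1)[OF t0])
  qed
  ultimately have L: "?L \<subseteq> ?S ` ?K"
    by (intro closure_minimal compact_imp_closed)
  then have "compact ?L"
    using compact_Int_closed[OF \<open>compact (?S ` ?K)\<close> closed_closure, of "{x. \<xi> (?T x) \<noteq> 0}"]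
    by (simp only: inf.absorb2)
  moreover have "?L \<subseteq> interior C"
  proof -
    let ?U = "?T -` interior (?T ` C)"
    have "open ?U"
      by (intro open_vimage open_interior continuous_intros)
    moreover have "?U \<subseteq> C"
    proof
      fix x assume "x \<in> ?U"
      then have "?T x \<in> ?T ` C" using interior_subset by blast
      then show "x \<in> C" using t0 by auto
    qed
    ultimately have "?U \<subseteq> interior C" by (rule interior_maximal[rotated])
    moreover have "?S ` ?K \<subseteq> ?U"
    proof
      fix x assume "x \<in> ?S ` ?K"
      then obtain y where y: "y \<in> ?K" "x = ?S y" by blast
      then have "?T x = y" by (simp only: homothety_inverse(2)[OF t0])
      then show "x \<in> ?U" using y(1) \<xi>D(3) by auto
    qed
    ultimately show ?thesis using L by (meson subset_trans)
  qed
  moreover have "smooth (\<lambda>x. \<xi> (?T x))"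
    using \<xi>D(1) unfolding smooth_def by (intro allI Ck_homothety) simp
  ultimately show ?thesis
    using \<xi>D(4) unfolding test_fields_def by simp
qed

text \<open>
  The change of variables contributes \<open>t ^ d\<close>, and pulling back the field multiplies its divergence by \<open>t\<close>,
  which uses up one of these factors.
\<close>

lemma rel_perimeter_homothety_le:
  fixes a :: "'a::euclidean_space"
  assumes t: "t > 0" and E: "E \<in> sets lebesgue"
  shows "rel_perimeter ((\<lambda>x. t *\<^sub>R x + a) ` C) ((\<lambda>x. t *\<^sub>R x + a) ` E)
    \<le> ereal (t ^ (DIM('a) - 1)) * rel_perimeter C E"
proof (rule rel_perimeter_least)
  let ?T = "\<lambda>x. t *\<^sub>R x + a"
  fix \<xi> assume \<xi>: "\<xi> \<in> test_fields (?T ` C)"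
  let ?\<eta> = "\<lambda>x. \<xi> (?T x)"
  note \<xi>D = test_fieldsD[OF \<xi>]
  have TE: "?T ` E \<in> sets lebesgue"
    using t E by (intro sets_lebesgue_homothety) auto
  have ind: "indicator (?T ` E) (?T x) = (indicator E x :: real)" for x
    using t by (auto simp: indicator_def)
  have m: "(\<lambda>x. indicator (?T ` E) x * div_field \<xi> x) \<in> borel_measurable lebesgue"
    using TE continuous_imp_lebesgue_measurable[OF continuous_div_field[OF \<xi>D(1)]]
    by (intro borel_measurable_times borel_measurable_indicator)
  have "(LINT x:?T ` E|lebesgue. div_field \<xi> x)
      = t ^ DIM('a) * (LINT x|lebesgue. indicator E x * div_field \<xi> (?T x))"
    unfolding set_lebesgue_integral_def real_scaleR_def
    by (subst lebesgue_integral_homothety[OF t m, of a]) (simp only: ind)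
  also have "\<dots> = t ^ (DIM('a) - 1) * (t * (LINT x|lebesgue. indicator E x * div_field \<xi> (?T x)))"
    using DIM_positive[where 'a='a] by (simp add: power_eq_if)
  also have "t * (LINT x|lebesgue. indicator E x * div_field \<xi> (?T x)) = (LINT x:E|lebesgue. div_field ?\<eta> x)"
    unfolding div_field_homothety[OF \<xi>D(1)] set_lebesgue_integral_def
    by (simp add: mult.left_commute)
  finally have "ereal (LINT x:?T ` E|lebesgue. div_field \<xi> x)
      = ereal (t ^ (DIM('a) - 1)) * ereal (LINT x:E|lebesgue. div_field ?\<eta> x)"
    by simp
  also have "\<dots> \<le> ereal (t ^ (DIM('a) - 1)) * rel_perimeter C E"
    using t by (intro ereal_mult_left_mono rel_perimeter_upper test_fields_homothety \<xi>) auto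
  finally show "ereal (LINT x:?T ` E|lebesgue. div_field \<xi> x)
      \<le> ereal (t ^ (DIM('a) - 1)) * rel_perimeter C E" .
qed

text \<open>
  Only one inequality is stated: the opposite one is the same statement for the inverse homothety.
\<close>

lemma iso_profile_homothety_le:
  fixes a :: "'a::euclidean_space"
  assumes t: "t > 0"
  shows "iso_profile ((\<lambda>x. t *\<^sub>R x + a) ` C) (s * measure lebesgue ((\<lambda>x. t *\<^sub>R x + a) ` C))
    \<le> ereal (t ^ (DIM('a) - 1)) * iso_profile C (s * measure lebesgue C)"
proof -
  let ?T = "\<lambda>x. t *\<^sub>R x + a" and ?c = "ereal (t ^ (DIM('a) - 1))"
  have c: "?c > 0" "?c \<noteq> \<infinity>" using t by auto
  have vol: "measure lebesgue (?T ` E) = t ^ DIM('a) * measure lebesgue E" for E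
    using measure_lebesgue_affine[of t a E] t by simp
  have "iso_profile (?T ` C) (s * measure lebesgue (?T ` C)) \<le> ?c * rel_perimeter C E"
    if E: "E \<subseteq> C" "E \<in> sets lebesgue" "measure lebesgue E = s * measure lebesgue C" for E
  proof -
    have "s * measure lebesgue (?T ` C) = measure lebesgue (?T ` E)"
      by (simp add: vol E(3))
    then have "iso_profile (?T ` C) (s * measure lebesgue (?T ` C)) \<le> rel_perimeter (?T ` C) (?T ` E)"
      using iso_profile_lower[OF image_mono[OF E(1)] sets_lebesgue_homothety[OF _ E(2)], of t a] t by simp
    also have "\<dots> \<le> ?c * rel_perimeter C E"
      by (rule rel_perimeter_homothety_le[OF t E(2)])
    finally show ?thesis .
  qed
  then have "iso_profile (?T ` C) (s * measure lebesgue (?T ` C)) / ?c \<le> iso_profile C (s * measure lebesgue C)"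
    unfolding iso_profile_def[of C] using c by (intro INF_greatest) (simp add: ereal_divide_le_pos)
  then show ?thesis using c by (simp add: ereal_divide_le_pos)
qed

section \<open>Sequences of convex bodies\<close>

lemma hausdorff_distance_lessD:
  fixes C D :: "'a::euclidean_space set"
  assumes "compact C" "C \<noteq> {}" "compact D" "D \<noteq> {}" "hausdorff_distance C D < e"
  obtains r where "r < e" "\<And>x. x \<in> C \<Longrightarrow> \<exists>y\<in>D. dist x y \<le> r" "\<And>x. x \<in> D \<Longrightarrow> \<exists>y\<in>C. dist x y \<le> r"
proof -
  let ?A = "{r. r > 0 \<and> C \<subseteq> closed_nbhd D r \<and> D \<subseteq> closed_nbhd C r}"
  obtain M where M: "\<And>x y. x \<in> C \<Longrightarrow> y \<in> D \<Longrightarrow> dist x y \<le> M"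
  proof -
    have "bounded (C \<union> D)" using assms(1,3) by (simp add: compact_imp_bounded)
    then obtain M where "\<And>x y. x \<in> C \<union> D \<Longrightarrow> y \<in> C \<union> D \<Longrightarrow> dist x y \<le> M"
      using bounded_two_points by metis
    then show ?thesis using that by blast
  qed
  obtain c d where cd: "c \<in> C" "d \<in> D" using assms(2,4) by blast
  have "max 1 M \<in> ?A"
  proof -
    have "infdist x D \<le> max 1 M" if "x \<in> C" for x
      using infdist_le[OF cd(2), of x] M[OF that cd(2)] by linarith
    moreover have "infdist x C \<le> max 1 M" if "x \<in> D" for x
      using infdist_le[OF cd(1), of x] M[OF cd(1) that] by (simp add: dist_commute)
    ultimately show ?thesis by (auto simp: closed_nbhd_def)
  qed
  then have "?A \<noteq> {}" by blast
  from cInf_lessD[OF this] obtain r where r: "r \<in> ?A" "r < e"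
    using assms(5) unfolding hausdorff_distance_def by blast
  have near: "\<exists>y\<in>B. dist x y \<le> r" if B: "compact B" "B \<noteq> {}" "x \<in> closed_nbhd B r" for B :: "'a set" and x
  proof -
    obtain y where "y \<in> B" "infdist x B = dist x y"
      using infdist_attains_inf[OF compact_imp_closed[OF B(1)] B(2)] by metis
    then show ?thesis using B(3) by (auto simp: closed_nbhd_def)
  qed
  show ?thesis
    by (rule that[OF r(2)]) (use r(1) near assms in blast)+
qed

text \<open>
  Upper inclusion: a point \<open>x\<close> of \<open>D\<close> is within \<open>\<eta> \<rho>\<close> of some \<open>y\<close> in \<open>C\<close>, and then \<open>x + \<eta> c = y + \<eta> q\<close> for a
  point \<open>q\<close> of the ball \<open>cball c \<rho>\<close>, so that the preimage of \<open>x\<close> is a convex combination of \<open>y\<close> and \<open>q\<close>.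
  
  Lower inclusion: if the image \<open>x\<close> of a point of \<open>C\<close> were not in \<open>D\<close>, then a hyperplane would separate
  it from \<open>D\<close>. Because \<open>x\<close> is a convex combination with \<open>c\<close>, moving it by \<open>\<eta> \<rho>\<close> away from that hyperplane
  does not leave \<open>C\<close>, and one arrives at a point of \<open>C\<close> too far from \<open>D\<close>.
\<close>

lemma convex_body_sandwich:
  fixes C D :: "'a::euclidean_space set"
  assumes C: "compact C" "convex C" and D: "compact D" "convex D" "D \<noteq> {}"
    and ball: "cball c \<rho> \<subseteq> C" "\<rho> > 0" and \<eta>: "0 < \<eta>" "\<eta> < 1"
    and dist: "hausdorff_distance D C < \<eta> * \<rho>"
  shows "(\<lambda>x. (1 - \<eta>) *\<^sub>R x + \<eta> *\<^sub>R c) ` C \<subseteq> D"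
    and "D \<subseteq> (\<lambda>x. (1 + \<eta>) *\<^sub>R x + (- \<eta>) *\<^sub>R c) ` C"
proof -
  have "c \<in> C" using ball by auto
  then have "C \<noteq> {}" by blast
  obtain r where r: "r < \<eta> * \<rho>" "\<And>x. x \<in> D \<Longrightarrow> \<exists>y\<in>C. dist x y \<le> r" "\<And>x. x \<in> C \<Longrightarrow> \<exists>y\<in>D. dist x y \<le> r"
    using hausdorff_distance_lessD[OF D(1,3) C(1) \<open>C \<noteq> {}\<close> dist] by blast
  show "(\<lambda>x. (1 - \<eta>) *\<^sub>R x + \<eta> *\<^sub>R c) ` C \<subseteq> D"
  proof (rule image_subsetI, rule ccontr)
    fix y assume y: "y \<in> C"
    let ?x = "(1 - \<eta>) *\<^sub>R y + \<eta> *\<^sub>R c"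
    assume x: "?x \<notin> D"
    define p where "p = closest_point D ?x"
    define a where "a = ?x - p"
    have "closed D" using D(1) by (rule compact_imp_closed)
    have p: "p \<in> D" using closest_point_in_set[OF \<open>closed D\<close> D(3)] by (simp add: p_def)
    then have a: "norm a > 0" using x by (auto simp: a_def)
    define u where "u = (\<rho> / norm a) *\<^sub>R a"
    have "c + u \<in> C"
      using ball a by (intro subsetD[OF ball(1)]) (simp add: u_def dist_norm)
    then have "(1 - \<eta>) *\<^sub>R y + \<eta> *\<^sub>R (c + u) \<in> C"
      using convexD_alt[OF C(2) y, of "c + u" \<eta>] \<eta> by simp
    then obtain z where z: "z \<in> D" "dist ((1 - \<eta>) *\<^sub>R y + \<eta> *\<^sub>R (c + u)) z \<le> r"
      using r(3) by blast
    define w where "w = ?x + \<eta> *\<^sub>R u"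
    have wz: "norm (w - z) \<le> r"
      using z(2) by (simp add: w_def dist_norm algebra_simps)
    have "a \<bullet> (z - p) \<le> 0"
      using closest_point_dot[OF D(2) \<open>closed D\<close> z(1), of ?x] by (simp add: a_def p_def)
    then have "a \<bullet> (w - p) \<le> a \<bullet> (w - z)"
      by (simp add: inner_diff_right)
    also have "\<dots> \<le> norm a * norm (w - z)" by (rule norm_cauchy_schwarz)
    also have "\<dots> \<le> norm a * r" using wz by (intro mult_left_mono) auto
    also have "\<dots> < norm a * (\<eta> * \<rho>)" using a r(1) by simp
    finally have "a \<bullet> (w - p) < norm a * (\<eta> * \<rho>)" .
    moreover have "a \<bullet> (w - p) = (norm a)\<^sup>2 + norm a * (\<eta> * \<rho>)"
    proof -
      have "w - p = a + (\<eta> * \<rho> / norm a) *\<^sub>R a" by (simp add: w_def a_def u_def)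
      then have "a \<bullet> (w - p) = (norm a)\<^sup>2 + (\<eta> * \<rho> / norm a) * (norm a)\<^sup>2"
        by (simp only: inner_add_right inner_scaleR_right power2_norm_eq_inner)
      then show ?thesis using a by (simp add: power2_eq_square)
    qed
    ultimately show False using zero_le_power2[of "norm a"] by linarith
  qed
  show "D \<subseteq> (\<lambda>x. (1 + \<eta>) *\<^sub>R x + (- \<eta>) *\<^sub>R c) ` C"
  proof
    fix x assume "x \<in> D"
    then obtain y where y: "y \<in> C" "dist x y \<le> r" using r(2) by blast
    define q where "q = c + (1 / \<eta>) *\<^sub>R (x - y)"
    have "q \<in> C"
    proof (rule subsetD[OF ball(1)])
      have "norm (x - y) / \<eta> \<le> \<rho>"
        using y(2) r(1) \<eta>(1) by (simp add: dist_norm divide_le_eq mult.commute)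
      then show "q \<in> cball c \<rho>" using \<eta>(1) by (simp add: q_def dist_norm)
    qed
    define z where "z = (1 / (1 + \<eta>)) *\<^sub>R y + (\<eta> / (1 + \<eta>)) *\<^sub>R q"
    have "z \<in> C"
      unfolding z_def using \<eta> by (intro convexD[OF C(2) y(1) \<open>q \<in> C\<close>]) (auto simp: add_divide_distrib[symmetric])
    moreover have "x = (1 + \<eta>) *\<^sub>R z + (- \<eta>) *\<^sub>R c"
    proof -
      have "(1 + \<eta>) *\<^sub>R z = y + \<eta> *\<^sub>R q"
        using \<eta> by (simp add: z_def scaleR_add_right)
      also have "\<eta> *\<^sub>R q = \<eta> *\<^sub>R c + (x - y)"
        using \<eta> by (simp add: q_def scaleR_add_right)
      finally show ?thesis by simp
    qed
    ultimately show "x \<in> (\<lambda>x. (1 + \<eta>) *\<^sub>R x + (- \<eta>) *\<^sub>R c) ` C" by blast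
  qed
qed

text \<open>
  All conditions are strict at \<open>\<eta> = 0\<close> and therefore hold near it. The first one says that the larger
  of the two scaled bodies exceeds the smaller one in volume by a factor of at most \<open>1 + \<kappa>\<close>.
\<close>

lemma homothety_parameter:
  fixes \<kappa> e :: real
  assumes "\<kappa> > 0" "e > 0"
  obtains \<eta> where "0 < \<eta>" "\<eta> < 1" "(1 + \<eta>) ^ d \<le> (1 + \<kappa>) * (1 - \<eta>) ^ d"
    "(1 / (1 - \<eta>)) ^ k \<le> 1 + e" "(1 + \<eta>) ^ k \<le> 1 + e"
proof -
  have cont: "((\<lambda>\<eta>::real. (1 + \<kappa>) * (1 - \<eta>) ^ d - (1 + \<eta>) ^ d) \<longlongrightarrow> (1 + \<kappa>) * (1 - 0) ^ d - (1 + 0) ^ d) (at_right 0)"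
    "((\<lambda>\<eta>::real. (1 / (1 - \<eta>)) ^ k) \<longlongrightarrow> (1 / (1 - 0)) ^ k) (at_right 0)"
    "((\<lambda>\<eta>::real. (1 + \<eta>) ^ k) \<longlongrightarrow> (1 + 0) ^ k) (at_right 0)"
    by (intro tendsto_intros; simp)+
  have "\<forall>\<^sub>F \<eta>::real in at_right 0. (1 + \<kappa>) * (1 - \<eta>) ^ d - (1 + \<eta>) ^ d > 0"
    using assms by (intro order_tendstoD(1)[OF cont(1)]) simp
  moreover have "\<forall>\<^sub>F \<eta>::real in at_right 0. (1 / (1 - \<eta>)) ^ k < 1 + e"
    using assms by (intro order_tendstoD(2)[OF cont(2)]) simp
  moreover have "\<forall>\<^sub>F \<eta>::real in at_right 0. (1 + \<eta>) ^ k < 1 + e"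
    using assms by (intro order_tendstoD(2)[OF cont(3)]) simp
  moreover have "\<forall>\<^sub>F \<eta>::real in at_right 0. \<eta> \<in> {0<..<1}"
    by (rule eventually_at_right_real) simp
  ultimately have "\<forall>\<^sub>F \<eta>::real in at_right 0. \<eta> \<in> {0<..<1} \<and> (1 + \<kappa>) * (1 - \<eta>) ^ d - (1 + \<eta>) ^ d > 0
      \<and> (1 / (1 - \<eta>)) ^ k < 1 + e \<and> (1 + \<eta>) ^ k < 1 + e"
    by eventually_elim simp
  then obtain \<eta> :: real where "\<eta> \<in> {0<..<1}" "(1 + \<kappa>) * (1 - \<eta>) ^ d - (1 + \<eta>) ^ d > 0"
      "(1 / (1 - \<eta>)) ^ k < 1 + e" "(1 + \<eta>) ^ k < 1 + e"
    using eventually_happens'[OF trivial_limit_at_right_real] by blast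
  then show ?thesis using that[of \<eta>] by auto
qed

text \<open>
  With \<open>S \<subseteq> C\<^sub>i \<subseteq> T\<close> for the scaled copies \<open>S\<close> and \<open>T\<close> of \<open>C\<close>, the comparison of domains gives
  \<open>I(S) \<le> I(C\<^sub>i) + e\<close> and \<open>I(C\<^sub>i) \<le> I(T) + e\<close>, while scaling relates \<open>I(S)\<close> and \<open>I(T)\<close> to \<open>I(C)\<close>.
\<close>

lemma iso_profile_convex_bodies_close:
  fixes C :: "'a::euclidean_space set" and Cs :: "nat \<Rightarrow> 'a set"
  assumes dim: "DIM('a) \<ge> 2" and Cs: "\<And>i. convex_body (Cs i)" and C: "convex_body C"
    and lim: "(\<lambda>i. hausdorff_distance (Cs i) C) \<longlonglongrightarrow> 0"
    and s: "0 < s" "s < 1" and e: "e > 0"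
  defines "I \<equiv> \<lambda>D. iso_profile D (s * measure lebesgue D)"
  shows "\<forall>\<^sub>F i in sequentially. I C \<le> ereal (1 + e) * (I (Cs i) + ereal e)
      \<and> I (Cs i) \<le> ereal (1 + e) * I C + ereal e"
proof -
  let ?d = "DIM('a)" and ?m = "measure lebesgue :: 'a set \<Rightarrow> real"
  have CC: "compact C" "convex C" "interior C \<noteq> {}"
    using C by (auto simp: convex_body_def)
  have CCs: "compact (Cs i)" "convex (Cs i)" "Cs i \<noteq> {}" for i
    using Cs[of i] by (auto simp: convex_body_def)
  obtain c \<rho> where ball: "\<rho> > 0" "cball c \<rho> \<subseteq> C"
    using CC(3) by (metis equals0I mem_interior_cball)
  obtain R0 where R0: "\<And>x. x \<in> C \<Longrightarrow> norm x \<le> R0"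
    using compact_imp_bounded[OF CC(1)] by (auto simp: bounded_iff)
  have c: "c \<in> C" using ball by auto
  obtain \<kappa> where \<kappa>: "\<kappa> > 0"
    "\<And>C D. (C::'a set) \<in> lmeasurable \<Longrightarrow> D \<in> lmeasurable \<Longrightarrow> D \<subseteq> C \<Longrightarrow> C \<subseteq> cball 0 (3 * R0) \<Longrightarrow>
      ?m C \<le> (1 + \<kappa>) * ?m D \<Longrightarrow> iso_profile D (s * ?m D) \<le> iso_profile C (s * ?m C) + ereal e"
    by (rule iso_profile_subdomain[OF dim e s, where R="3 * R0"]) blast
  obtain \<eta> where \<eta>: "0 < \<eta>" "\<eta> < 1" "(1 + \<eta>) ^ ?d \<le> (1 + \<kappa>) * (1 - \<eta>) ^ ?d"
    "(1 / (1 - \<eta>)) ^ (?d - 1) \<le> 1 + e" "(1 + \<eta>) ^ (?d - 1) \<le> 1 + e"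
    using homothety_parameter[OF \<kappa>(1) e] by blast
  define S where "S = (\<lambda>x. (1 - \<eta>) *\<^sub>R x + \<eta> *\<^sub>R c) ` C"
  define T where "T = (\<lambda>x. (1 + \<eta>) *\<^sub>R x + (- \<eta>) *\<^sub>R c) ` C"
  have volS: "?m S = (1 - \<eta>) ^ ?d * ?m C"
    unfolding S_def using measure_lebesgue_affine[of "1 - \<eta>" "\<eta> *\<^sub>R c" C] \<eta> by simp
  have volT: "?m T = (1 + \<eta>) ^ ?d * ?m C"
    unfolding T_def using measure_lebesgue_affine[of "1 + \<eta>" "(- \<eta>) *\<^sub>R c" C] \<eta> by simp
  have vol: "?m T \<le> (1 + \<kappa>) * ?m S"
    using mult_right_mono[OF \<eta>(3), of "?m C"] by (simp add: volS volT mult.assoc)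
  have meas: "S \<in> lmeasurable" "T \<in> lmeasurable" "Cs i \<in> lmeasurable" for i
    unfolding S_def T_def using CC(1) CCs(1)
    by (auto intro!: lmeasurable_compact compact_continuous_image continuous_intros)
  \<comment> \<open>The radius must not depend on \<open>\<eta>\<close>, which is chosen after \<open>\<kappa>\<close> and hence after the radius.\<close>
  have T_bounded: "T \<subseteq> cball 0 (3 * R0)"
  proof
    fix x assume "x \<in> T"
    then obtain y where y: "y \<in> C" "x = (1 + \<eta>) *\<^sub>R y + (- \<eta>) *\<^sub>R c" unfolding T_def by blast
    have "norm x \<le> norm ((1 + \<eta>) *\<^sub>R y) + norm ((- \<eta>) *\<^sub>R c)"
      unfolding y(2) by (rule norm_triangle_ineq)
    also have "\<dots> = (1 + \<eta>) * norm y + \<eta> * norm c" using \<eta> by simp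
    also have "\<dots> \<le> 2 * R0 + 1 * R0"
      using \<eta> R0[OF y(1)] R0[OF c] by (intro add_mono mult_mono) auto
    finally show "x \<in> cball 0 (3 * R0)" by simp
  qed
  have IS: "I C \<le> ereal (1 + e) * I S"
  proof -
    have inv: "(\<lambda>x. (1 / (1 - \<eta>)) *\<^sub>R x + (- (\<eta> / (1 - \<eta>))) *\<^sub>R c) ` S = C"
      unfolding S_def image_image using \<eta> by (simp add: scaleR_add_right)
    have "I C \<le> ereal ((1 / (1 - \<eta>)) ^ (?d - 1)) * I S"
      using iso_profile_homothety_le[of "1 / (1 - \<eta>)" "(- (\<eta> / (1 - \<eta>))) *\<^sub>R c" S s] \<eta>
      unfolding inv I_def by simp
    also have "\<dots> \<le> ereal (1 + e) * I S"
      using \<eta>(4) by (intro ereal_mult_right_mono) (auto simp: I_def iso_profile_nonneg)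
    finally show ?thesis .
  qed
  have IT: "I T \<le> ereal (1 + e) * I C"
  proof -
    have "I T \<le> ereal ((1 + \<eta>) ^ (?d - 1)) * I C"
      using iso_profile_homothety_le[of "1 + \<eta>" "(- \<eta>) *\<^sub>R c" C s] \<eta>
      unfolding T_def I_def by simp
    also have "\<dots> \<le> ereal (1 + e) * I C"
      using \<eta>(5) by (intro ereal_mult_right_mono) (auto simp: I_def iso_profile_nonneg)
    finally show ?thesis .
  qed
  have "\<forall>\<^sub>F i in sequentially. hausdorff_distance (Cs i) C < \<eta> * \<rho>"
    using ball \<eta> by (intro order_tendstoD(2)[OF lim]) simp
  then show ?thesis
  proof eventually_elim
    case (elim i)
    have sub: "S \<subseteq> Cs i" "Cs i \<subseteq> T"
      unfolding S_def T_def
      using convex_body_sandwich[OF CC(1,2) CCs ball(2,1) \<eta>(1,2) elim] by auto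
    have m: "?m S \<le> ?m (Cs i)" "?m (Cs i) \<le> ?m T"
      using sub meas by (auto intro!: measure_mono_fmeasurable)
    have "I S \<le> I (Cs i) + ereal e"
      unfolding I_def using m vol
      by (intro \<kappa>(2)[OF meas(3,1) sub(1) subset_trans[OF sub(2) T_bounded]]) linarith
    then have "ereal (1 + e) * I S \<le> ereal (1 + e) * (I (Cs i) + ereal e)"
      using e by (intro ereal_mult_left_mono) auto
    moreover have "?m T \<le> (1 + \<kappa>) * ?m (Cs i)"
      using vol mult_left_mono[OF m(1), of "1 + \<kappa>"] \<kappa>(1) by linarith
    then have "I (Cs i) \<le> I T + ereal e"
      unfolding I_def by (intro \<kappa>(2)[OF meas(2,3) sub(2) T_bounded])
    ultimately show ?case
      using IS IT by (meson add_right_mono order_trans)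
  qed
qed

text \<open>
  An infinite limit forces the terms to be eventually infinite, and the coercion sends all of these to
  \<open>0\<close>. A finite limit makes the terms eventually finite and the estimate one between reals.
\<close>

lemma real_of_ereal_tendsto:
  fixes f :: "nat \<Rightarrow> ereal" and l :: ereal
  assumes nonneg: "\<And>i. 0 \<le> f i" "0 \<le> l"
    and close: "\<And>e::real. e > 0 \<Longrightarrow>
      \<forall>\<^sub>F i in sequentially. l \<le> ereal (1 + e) * (f i + ereal e) \<and> f i \<le> ereal (1 + e) * l + ereal e"
  shows "(\<lambda>i. real_of_ereal (f i)) \<longlonglongrightarrow> real_of_ereal l"
proof (cases l)
  case PInf
  from close[of 1] have "\<forall>\<^sub>F i in sequentially. real_of_ereal (f i) = real_of_ereal l"
  proof (rule eventually_mono)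
    fix i
    assume "l \<le> ereal (1 + 1) * (f i + ereal 1) \<and> f i \<le> ereal (1 + 1) * l + ereal 1"
    then have "f i = \<infinity>" using nonneg(1)[of i] PInf by (cases "f i") auto
    then show "real_of_ereal (f i) = real_of_ereal l" using PInf by simp
  qed simp
  then show ?thesis by (simp add: tendsto_eventually)
next
  case MInf
  then show ?thesis using nonneg by simp
next
  case (real j)
  have j: "j \<ge> 0" using nonneg(2) real by simp
  show ?thesis
  proof (rule tendstoI)
    fix \<delta> :: real assume \<delta>: "\<delta> > 0"
    \<comment> \<open>For \<open>e \<le> 1\<close> the term is at most \<open>2 j + 1\<close>, so both deviations stay below \<open>e (2 j + 4)\<close>.\<close>
    define e where "e = min 1 (\<delta> / (2 * j + 4))"
    have e: "e > 0" "e \<le> 1" using \<delta> j by (auto simp: e_def)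
    have "e * (2 * j + 4) \<le> \<delta> / (2 * j + 4) * (2 * j + 4)"
      using j by (intro mult_right_mono) (auto simp: e_def)
    then have ej: "e * (2 * j + 4) \<le> \<delta>" using j by simp
    from close[OF e(1)] show "\<forall>\<^sub>F i in sequentially. dist (real_of_ereal (f i)) (real_of_ereal l) < \<delta>"
    proof (rule eventually_mono)
      fix i assume *: "l \<le> ereal (1 + e) * (f i + ereal e) \<and> f i \<le> ereal (1 + e) * l + ereal e"
      then obtain x where x: "f i = ereal x"
        using nonneg(1)[of i] real by (cases "f i") auto
      have 1: "j \<le> (1 + e) * (x + e)" and 2: "x \<le> (1 + e) * j + e"
        using * by (auto simp: x real)
      have "e * x \<le> e * (2 * j + 1)"
      proof (rule mult_left_mono)
        have "e * j \<le> 1 * j" using e j by (intro mult_right_mono) auto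
        then show "x \<le> 2 * j + 1" using 2 e by (simp add: algebra_simps)
      qed (use e in simp)
      moreover have "e * e \<le> e * 1" using e by (intro mult_left_mono) auto
      moreover have "(1 + e) * (x + e) = x + e * x + e + e * e"
          "e * (2 * j + 1) + e + e * 1 = e * (2 * j + 4) - e"
        by (simp_all add: algebra_simps)
      ultimately have "j - x < \<delta>" using 1 ej e(1) by linarith
      moreover have "x - j < \<delta>"
      proof -
        have "0 \<le> e * j" using e j by simp
        then show ?thesis using 2 ej e by (simp add: algebra_simps)
      qed
      ultimately show "dist (real_of_ereal (f i)) (real_of_ereal l) < \<delta>"
        by (simp add: x real dist_real_def abs_less_iff)
    qed
  qed
qed

lemma norm_profile_0: "norm_profile C 0 = 0"
proof -
  have "iso_profile C 0 = 0"
    using iso_profile_lower[of "{}" C] iso_profile_nonneg[of C 0]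
    by (intro antisym) (simp_all add: rel_perimeter_empty)
  then show ?thesis by (simp add: norm_profile_def)
qed

lemma norm_profile_1:
  assumes "C \<in> sets lebesgue"
  shows "norm_profile C 1 = 0"
proof -
  have "iso_profile C (measure lebesgue C) = 0"
    using iso_profile_lower[OF subset_refl assms] iso_profile_nonneg[of C]
    by (intro antisym) (simp_all add: rel_perimeter_self)
  then show ?thesis by (simp add: norm_profile_def)
qed

lemma norm_profile_nonneg: "0 \<le> norm_profile C s"
  by (simp add: norm_profile_def real_of_ereal_pos iso_profile_nonneg)

lemma norm_profile_tendsto:
  fixes C :: "'a::euclidean_space set" and Cs :: "nat \<Rightarrow> 'a set"
  assumes dim: "DIM('a) \<ge> 2" and Cs: "\<And>i. convex_body (Cs i)" and C: "convex_body C"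
    and lim: "(\<lambda>i. hausdorff_distance (Cs i) C) \<longlonglongrightarrow> 0" and s: "s \<in> {0..1}"
  shows "(\<lambda>i. norm_profile (Cs i) s) \<longlonglongrightarrow> norm_profile C s"
proof -
  have meas: "D \<in> sets lebesgue" if "convex_body D" for D :: "'a set"
    using that by (intro fmeasurableD lmeasurable_compact) (simp add: convex_body_def)
  consider "s = 0" | "s = 1" | "0 < s" "s < 1" using s by fastforce
  then show ?thesis
  proof cases
    case 3
    show ?thesis
      unfolding norm_profile_def
      by (intro real_of_ereal_tendsto iso_profile_nonneg
          iso_profile_convex_bodies_close[OF dim Cs C lim 3])
  qed (simp_all add: norm_profile_0 norm_profile_1[OF meas] Cs C)
qed

theorem theorem4p1:
  fixes n :: nat
    and Cs :: "nat \<Rightarrow> (real ^ 'm) set"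
    and C :: "(real ^ 'm) set"
  assumes "n \<ge> 1"
    and "CARD('m) = n + 1"
    and "\<And>i. convex_body (Cs i)"
    and "convex_body C"
    and "(\<lambda>i. hausdorff_distance (Cs i) C) \<longlonglongrightarrow> 0"
  shows "(\<forall>s\<in>{0..1}. (\<lambda>i. norm_profile (Cs i) s) \<longlonglongrightarrow> norm_profile C s) \<and>
    (\<forall>s\<in>{0..1}. (\<lambda>i. norm_profile_pow n (Cs i) s) \<longlonglongrightarrow> norm_profile_pow n C s)"
proof -
  have "DIM(real ^ 'm) \<ge> 2" using assms(1,2) by simp
  then have J: "(\<lambda>i. norm_profile (Cs i) s) \<longlonglongrightarrow> norm_profile C s" if "s \<in> {0..1}" for s
    using assms(3-5) that by (rule norm_profile_tendsto)
  have "(\<lambda>i. norm_profile_pow n (Cs i) s) \<longlonglongrightarrow> norm_profile_pow n C s" if "s \<in> {0..1}" for s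
    unfolding norm_profile_pow_def using assms(1)
    by (intro tendsto_powr2 tendsto_const J that) (auto simp: norm_profile_nonneg)
  with J show ?thesis by blast
qed

end
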